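(* Let $G$ be a profinite group, $(A,B,C)$ a Tate product over $G$, and $r,s\ge0$ integers. Let $\alpha''\in H^r(G,A'')$ and $\beta''\in H^s(G,B'')$, and choose cochains $f\in C^r(G,A)$, $g\in C^s(G,B)$ such that $j_*f\in Z^r(G,A'')$ represents $\alpha''$ and $j_*g\in Z^s(G,B'')$ represents $\beta''$. Then: (a) $d_rf\in C^{r+1}(G,A')$ and $d_sg\in C^{s+1}(G,B')$, so that the cup products $d_rf\cup g$ (via $A'\times B\to C$) and $f\cup d_sg$ (via $A\times B'\to C$) are defined. (b) $d_rf\cup g+(-1)^rf\cup d_sg\in C^{r+s+1}(G,C)$ is a cocycle. (c) The cohomology class $[d_rf\cup g+(-1)^rf\cup d_sg]\in H^{r+s+1}(G,C)$ depends only on $\alpha''$ and $\beta''$, not on the choice of $f$ and $g$. Consequently the augmented cup product $\cup_{\mathrm{aug}}:H^r(G,A'')\times H^s(G,B'')\to H^{r+s+1}(G,C)$, $\alpha''\cup_{\mathrm{aug}}\beta''=[d_rf\cup g+(-1)^rf\cup d_sg]$, is well defined.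
   Context: For a discrete $G$-module $A$, $C^r(G,A)$ is the group of continuous maps $G^r\to A$, with coboundary $d_rf(x_1,\ldots,x_{r+1})=x_1 f(x_2,\ldots,x_{r+1})+\sum_{i=1}^r(-1)^i f(x_1,\ldots,x_ix_{i+1},\ldots,x_{r+1})+(-1)^{r+1}f(x_1,\ldots,x_r)$; $Z^r=\ker d_r$, $B^r=\operatorname{im} d_{r-1}$, $H^r=Z^r/B^r$. A map $A\times B\to C$, $(a,b)\mapsto a\times b$, of discrete $G$-modules is $G$-bilinear if it is bilinear and $g(a\times b)=ga\times gb$. It induces the cup product $\cup:C^r(G,A)\times C^s(G,B)\to C^{r+s}(G,C)$, $(f\cup g)(x_1,\ldots,x_{r+s})=f(x_1,\ldots,x_r)\times x_1\cdots x_r\, g(x_{r+1},\ldots,x_{r+s})$. A Tate product $(A,B,C)$ over $G$ consists of two short exact sequences of discrete $G$-modules $0\to A'\xrightarrow{i}A\xrightarrow{j}A''\to0$ and $0\to B'\xrightarrow{i}B\xrightarrow{j}B''\to0$, a discrete $G$-module $C$, and two $G$-bilinear maps $A'\times B\to C$ and $A\times B'\to C$ that coincide on $A'\times B'$. One identifies $C^r(G,A')$ with $\ker(j_*:C^r(G,A)\to C^r(G,A''))$, and similarly for $B'$. *)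

theory Defs
  imports "HOL-Analysis.Analysis" "HOL-Algebra.Coset" "HOL-Algebra.Module"
begin

section \<open>Profinite groups and discrete modules\<close>

record 'g top_group = "'g monoid" +
  group_top :: "'g topology"

locale topological_group = group G for G :: "'g top_group" (structure) +
  assumes topspace_group_top: "topspace (group_top G) = carrier G"
    and continuous_mult:
      "continuous_map (prod_topology (group_top G) (group_top G)) (group_top G) (\<lambda>(x, y). x \<otimes> y)"
    and continuous_inv: "continuous_map (group_top G) (group_top G) (\<lambda>x. inv x)"

locale profinite_group = topological_group +
  assumes compact: "compact_space (group_top G)"
    and Hausdorff: "Hausdorff_space (group_top G)"
    and totally_disconnected: "connectedin (group_top G) S \<Longrightarrow> \<exists>x. S \<subseteq> {x}"

text \<open>
  A \<open>G\<close>-module is an abelian group, written with the additive operations of the library's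
  \<^type>\<open>module\<close> record, on which \<open>G\<close> acts through the operation \<open>\<odot>\<close> of that record.
  The scalars are thus elements of the group \<open>G\<close>, and the ring multiplication and unit of the
  record are ignored.
\<close>

locale discrete_module = topological_group G + A: abelian_group A
  for G :: "'g top_group" and A :: "('g, 'a) module" +
  assumes act_closed: "\<lbrakk>x \<in> carrier G; a \<in> carrier A\<rbrakk> \<Longrightarrow> x \<odot>\<^bsub>A\<^esub> a \<in> carrier A"
    and act_add: "\<lbrakk>x \<in> carrier G; a \<in> carrier A; b \<in> carrier A\<rbrakk>
      \<Longrightarrow> x \<odot>\<^bsub>A\<^esub> (a \<oplus>\<^bsub>A\<^esub> b) = x \<odot>\<^bsub>A\<^esub> a \<oplus>\<^bsub>A\<^esub> x \<odot>\<^bsub>A\<^esub> b"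
    and act_one: "a \<in> carrier A \<Longrightarrow> \<one>\<^bsub>G\<^esub> \<odot>\<^bsub>A\<^esub> a = a"
    and act_mult: "\<lbrakk>x \<in> carrier G; y \<in> carrier G; a \<in> carrier A\<rbrakk>
      \<Longrightarrow> (x \<otimes>\<^bsub>G\<^esub> y) \<odot>\<^bsub>A\<^esub> a = x \<odot>\<^bsub>A\<^esub> (y \<odot>\<^bsub>A\<^esub> a)"
    and act_continuous:
      "continuous_map (prod_topology (group_top G) (discrete_topology (carrier A)))
         (discrete_topology (carrier A)) (\<lambda>(x, a). x \<odot>\<^bsub>A\<^esub> a)"

definition equivariant ::
    "'g top_group \<Rightarrow> ('g, 'a) module \<Rightarrow> ('g, 'b) module \<Rightarrow> ('a \<Rightarrow> 'b) \<Rightarrow> bool" where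
  "equivariant G A B h \<longleftrightarrow>
     (\<forall>x\<in>carrier G. \<forall>a\<in>carrier A. h (x \<odot>\<^bsub>A\<^esub> a) = x \<odot>\<^bsub>B\<^esub> h a)"

text \<open>
  The library's notion of exact sequence requires all groups to live on the same type, hence
  the following explicit version.
\<close>

definition short_exact ::
    "'g top_group \<Rightarrow> ('g, 'a) module \<Rightarrow> ('g, 'b) module \<Rightarrow> ('g, 'c) module
      \<Rightarrow> ('a \<Rightarrow> 'b) \<Rightarrow> ('b \<Rightarrow> 'c) \<Rightarrow> bool" where
  "short_exact G A' A A'' i j \<longleftrightarrow>
     discrete_module G A' \<and> discrete_module G A \<and> discrete_module G A'' \<and>
     i \<in> mon (add_monoid A') (add_monoid A) \<and> equivariant G A' A i \<and>
     j \<in> epi (add_monoid A) (add_monoid A'') \<and> equivariant G A A'' j \<and>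
     i ` carrier A' = Coset.kernel (add_monoid A) (add_monoid A'') j"

definition G_bilinear ::
    "'g top_group \<Rightarrow> ('g, 'a) module \<Rightarrow> ('g, 'b) module \<Rightarrow> ('g, 'c) module
      \<Rightarrow> ('a \<Rightarrow> 'b \<Rightarrow> 'c) \<Rightarrow> bool" where
  "G_bilinear G A B C p \<longleftrightarrow>
     (\<forall>a\<in>carrier A. \<forall>b\<in>carrier B. p a b \<in> carrier C) \<and>
     (\<forall>a\<in>carrier A. \<forall>a'\<in>carrier A. \<forall>b\<in>carrier B.
        p (a \<oplus>\<^bsub>A\<^esub> a') b = p a b \<oplus>\<^bsub>C\<^esub> p a' b) \<and>
     (\<forall>a\<in>carrier A. \<forall>b\<in>carrier B. \<forall>b'\<in>carrier B.
        p a (b \<oplus>\<^bsub>B\<^esub> b') = p a b \<oplus>\<^bsub>C\<^esub> p a b') \<and>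
     (\<forall>x\<in>carrier G. \<forall>a\<in>carrier A. \<forall>b\<in>carrier B.
        x \<odot>\<^bsub>C\<^esub> p a b = p (x \<odot>\<^bsub>A\<^esub> a) (x \<odot>\<^bsub>B\<^esub> b))"


section \<open>Continuous cochains and cohomology\<close>

text \<open>
  A tuple \<open>(x\<^sub>1, \<dots>, x\<^sub>r)\<close> is an extensional function on \<open>{1..r}\<close>, so that
  \<open>tuples G r\<close> is the underlying set of the power \<open>G\<^sup>r\<close> with its product topology.
  Cochains are extensional functions on it, so that equality of cochains is equality of maps.
\<close>

definition tuples :: "'g top_group \<Rightarrow> nat \<Rightarrow> (nat \<Rightarrow> 'g) set" where
  "tuples G r = {1..r} \<rightarrow>\<^sub>E carrier G"

definition power_top :: "'g top_group \<Rightarrow> nat \<Rightarrow> (nat \<Rightarrow> 'g) topology" where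
  "power_top G r = product_topology (\<lambda>_. group_top G) {1..r}"

definition cochains :: "'g top_group \<Rightarrow> nat \<Rightarrow> ('g, 'a) module \<Rightarrow> ((nat \<Rightarrow> 'g) \<Rightarrow> 'a) set" where
  "cochains G r A = {f \<in> extensional (tuples G r).
     continuous_map (power_top G r) (discrete_topology (carrier A)) f}"

text \<open>The group \<open>C\<^sup>r(G, A)\<close> under pointwise addition, here a (multiplicative) group record.\<close>

definition cochain_group ::
    "'g top_group \<Rightarrow> nat \<Rightarrow> ('g, 'a) module \<Rightarrow> ((nat \<Rightarrow> 'g) \<Rightarrow> 'a) monoid" where
  "cochain_group G r A =
     \<lparr>carrier = cochains G r A,
      monoid.mult = (\<lambda>f g. \<lambda>x\<in>tuples G r. f x \<oplus>\<^bsub>A\<^esub> g x),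
      one = (\<lambda>x\<in>tuples G r. \<zero>\<^bsub>A\<^esub>)\<rparr>"

text \<open>
  In \<open>coboundary\<close> the three shapes of argument are \<open>(x\<^sub>2, \<dots>, x\<^bsub>r+1\<^esub>)\<close>,
  \<open>(x\<^sub>1, \<dots>, x\<^sub>i x\<^bsub>i+1\<^esub>, \<dots>, x\<^bsub>r+1\<^esub>)\<close> and \<open>(x\<^sub>1, \<dots>, x\<^sub>r)\<close>.
\<close>

definition shift :: "nat \<Rightarrow> nat \<Rightarrow> (nat \<Rightarrow> 'g) \<Rightarrow> nat \<Rightarrow> 'g" where
  "shift m n x = (\<lambda>k\<in>{1..n}. x (m + k))"

definition contract :: "'g top_group \<Rightarrow> nat \<Rightarrow> nat \<Rightarrow> (nat \<Rightarrow> 'g) \<Rightarrow> nat \<Rightarrow> 'g" where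
  "contract G i n x =
     (\<lambda>k\<in>{1..n}. if k < i then x k else if k = i then x i \<otimes>\<^bsub>G\<^esub> x (i + 1) else x (k + 1))"

definition coboundary ::
    "'g top_group \<Rightarrow> nat \<Rightarrow> ('g, 'a) module \<Rightarrow> ((nat \<Rightarrow> 'g) \<Rightarrow> 'a) \<Rightarrow> (nat \<Rightarrow> 'g) \<Rightarrow> 'a" where
  "coboundary G r A f = (\<lambda>x\<in>tuples G (r + 1).
     x 1 \<odot>\<^bsub>A\<^esub> f (shift 1 r x)
     \<oplus>\<^bsub>A\<^esub> (\<Oplus>\<^bsub>A\<^esub>i\<in>{1..r}. add_pow A ((-1) ^ i :: int) (f (contract G i r x)))
     \<oplus>\<^bsub>A\<^esub> add_pow A ((-1) ^ (r + 1) :: int) (f (restrict x {1..r})))"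

definition cocycles :: "'g top_group \<Rightarrow> nat \<Rightarrow> ('g, 'a) module \<Rightarrow> ((nat \<Rightarrow> 'g) \<Rightarrow> 'a) set" where
  "cocycles G r A =
     Coset.kernel (cochain_group G r A) (cochain_group G (r + 1) A) (coboundary G r A)"

text \<open>\<open>B\<^sup>0 = 0\<close>, there being no cochains in degree \<open>-1\<close>.\<close>

definition coboundaries :: "'g top_group \<Rightarrow> nat \<Rightarrow> ('g, 'a) module \<Rightarrow> ((nat \<Rightarrow> 'g) \<Rightarrow> 'a) set" where
  "coboundaries G r A =
     (if r = 0 then {\<one>\<^bsub>cochain_group G 0 A\<^esub>}
      else coboundary G (r - 1) A ` cochains G (r - 1) A)"

definition cocycle_group ::
    "'g top_group \<Rightarrow> nat \<Rightarrow> ('g, 'a) module \<Rightarrow> ((nat \<Rightarrow> 'g) \<Rightarrow> 'a) monoid" where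
  "cocycle_group G r A = (cochain_group G r A)\<lparr>carrier := cocycles G r A\<rparr>"

definition cohomology ::
    "'g top_group \<Rightarrow> nat \<Rightarrow> ('g, 'a) module \<Rightarrow> ((nat \<Rightarrow> 'g) \<Rightarrow> 'a) set monoid" where
  "cohomology G r A = cocycle_group G r A Mod coboundaries G r A"

definition coh_class ::
    "'g top_group \<Rightarrow> nat \<Rightarrow> ('g, 'a) module \<Rightarrow> ((nat \<Rightarrow> 'g) \<Rightarrow> 'a) \<Rightarrow> ((nat \<Rightarrow> 'g) \<Rightarrow> 'a) set" where
  "coh_class G r A f = coboundaries G r A #>\<^bsub>cocycle_group G r A\<^esub> f"

text \<open>The map \<open>h\<^sub>*\<close> on cochains of degree \<open>r\<close> induced by a map \<open>h\<close> of modules.\<close>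

definition push ::
    "'g top_group \<Rightarrow> nat \<Rightarrow> ('a \<Rightarrow> 'b) \<Rightarrow> ((nat \<Rightarrow> 'g) \<Rightarrow> 'a) \<Rightarrow> (nat \<Rightarrow> 'g) \<Rightarrow> 'b" where
  "push G r h f = compose (tuples G r) h f"

primrec tuple_prod :: "'g top_group \<Rightarrow> nat \<Rightarrow> (nat \<Rightarrow> 'g) \<Rightarrow> 'g" where
  "tuple_prod G 0 x = \<one>\<^bsub>G\<^esub>"
| "tuple_prod G (Suc r) x = tuple_prod G r x \<otimes>\<^bsub>G\<^esub> x (Suc r)"

definition cup ::
    "'g top_group \<Rightarrow> nat \<Rightarrow> nat \<Rightarrow> ('g, 'b) module \<Rightarrow> ('a \<Rightarrow> 'b \<Rightarrow> 'c)
      \<Rightarrow> ((nat \<Rightarrow> 'g) \<Rightarrow> 'a) \<Rightarrow> ((nat \<Rightarrow> 'g) \<Rightarrow> 'b) \<Rightarrow> (nat \<Rightarrow> 'g) \<Rightarrow> 'c" where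
  "cup G r s B p f g = (\<lambda>x\<in>tuples G (r + s).
     p (f (restrict x {1..r})) (tuple_prod G r x \<odot>\<^bsub>B\<^esub> g (shift r s x)))"


section \<open>Tate products and the augmented cup product\<close>

text \<open>
  The field \<open>tpair1\<close> is the pairing \<open>A' \<times> B \<rightarrow> C\<close>, and \<open>tpair2\<close> is \<open>A \<times> B' \<rightarrow> C\<close>.
\<close>

record ('g, 'a1, 'a, 'a2, 'b1, 'b, 'b2, 'c) tate_data =
  tA' :: "('g, 'a1) module"
  tA :: "('g, 'a) module"
  tA'' :: "('g, 'a2) module"
  tiA :: "'a1 \<Rightarrow> 'a"
  tjA :: "'a \<Rightarrow> 'a2"
  tB' :: "('g, 'b1) module"
  tB :: "('g, 'b) module"
  tB'' :: "('g, 'b2) module"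
  tiB :: "'b1 \<Rightarrow> 'b"
  tjB :: "'b \<Rightarrow> 'b2"
  tC :: "('g, 'c) module"
  tpair1 :: "'a1 \<Rightarrow> 'b \<Rightarrow> 'c"
  tpair2 :: "'a \<Rightarrow> 'b1 \<Rightarrow> 'c"

definition tate_product ::
    "'g top_group \<Rightarrow> ('g, 'a1, 'a, 'a2, 'b1, 'b, 'b2, 'c) tate_data \<Rightarrow> bool" where
  "tate_product G P \<longleftrightarrow>
     short_exact G (tA' P) (tA P) (tA'' P) (tiA P) (tjA P) \<and>
     short_exact G (tB' P) (tB P) (tB'' P) (tiB P) (tjB P) \<and>
     discrete_module G (tC P) \<and>
     G_bilinear G (tA' P) (tB P) (tC P) (tpair1 P) \<and>
     G_bilinear G (tA P) (tB' P) (tC P) (tpair2 P) \<and>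
     (\<forall>a\<in>carrier (tA' P). \<forall>b\<in>carrier (tB' P).
        tpair1 P a (tiB P b) = tpair2 P (tiA P a) b)"

text \<open>
  \<open>as_sub G r A' i h\<close> is the cochain with values in \<open>A'\<close> that is identified, along
  \<open>i\<^sub>*\<close>, with the cochain \<open>h\<close> with values in \<open>A\<close>. It is meaningful only when \<open>h\<close> is in
  the image of \<open>i\<^sub>*\<close>.
\<close>

definition as_sub ::
    "'g top_group \<Rightarrow> nat \<Rightarrow> ('g, 'a1) module \<Rightarrow> ('a1 \<Rightarrow> 'a)
      \<Rightarrow> ((nat \<Rightarrow> 'g) \<Rightarrow> 'a) \<Rightarrow> (nat \<Rightarrow> 'g) \<Rightarrow> 'a1" where
  "as_sub G r A' i h = inv_into (cochains G r A') (push G r i) h"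

text \<open>\<open>d\<^sub>r f \<union> g\<close> and \<open>f \<union> d\<^sub>s g\<close>, using the identification above.\<close>

definition cup_d_left ::
    "'g top_group \<Rightarrow> ('g, 'a1, 'a, 'a2, 'b1, 'b, 'b2, 'c) tate_data \<Rightarrow> nat \<Rightarrow> nat
      \<Rightarrow> ((nat \<Rightarrow> 'g) \<Rightarrow> 'a) \<Rightarrow> ((nat \<Rightarrow> 'g) \<Rightarrow> 'b) \<Rightarrow> (nat \<Rightarrow> 'g) \<Rightarrow> 'c" where
  "cup_d_left G P r s f g =
     cup G (r + 1) s (tB P) (tpair1 P)
       (as_sub G (r + 1) (tA' P) (tiA P) (coboundary G r (tA P) f)) g"

definition cup_d_right ::
    "'g top_group \<Rightarrow> ('g, 'a1, 'a, 'a2, 'b1, 'b, 'b2, 'c) tate_data \<Rightarrow> nat \<Rightarrow> nat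
      \<Rightarrow> ((nat \<Rightarrow> 'g) \<Rightarrow> 'a) \<Rightarrow> ((nat \<Rightarrow> 'g) \<Rightarrow> 'b) \<Rightarrow> (nat \<Rightarrow> 'g) \<Rightarrow> 'c" where
  "cup_d_right G P r s f g =
     cup G r (s + 1) (tB' P) (tpair2 P)
       f (as_sub G (s + 1) (tB' P) (tiB P) (coboundary G s (tB P) g))"

definition aug_cochain ::
    "'g top_group \<Rightarrow> ('g, 'a1, 'a, 'a2, 'b1, 'b, 'b2, 'c) tate_data \<Rightarrow> nat \<Rightarrow> nat
      \<Rightarrow> ((nat \<Rightarrow> 'g) \<Rightarrow> 'a) \<Rightarrow> ((nat \<Rightarrow> 'g) \<Rightarrow> 'b) \<Rightarrow> (nat \<Rightarrow> 'g) \<Rightarrow> 'c" where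
  "aug_cochain G P r s f g = (\<lambda>x\<in>tuples G (r + s + 1).
     cup_d_left G P r s f g x
     \<oplus>\<^bsub>tC P\<^esub> add_pow (tC P) ((-1) ^ r :: int) (cup_d_right G P r s f g x))"

text \<open>
  The admissible choices: cochains \<open>f\<close> with values in \<open>A\<close> such that \<open>j\<^sub>* f\<close> is a cocycle
  representing the class \<open>\<alpha>\<close>.
\<close>

definition lifts ::
    "'g top_group \<Rightarrow> nat \<Rightarrow> ('g, 'a) module \<Rightarrow> ('g, 'a2) module \<Rightarrow> ('a \<Rightarrow> 'a2)
      \<Rightarrow> ((nat \<Rightarrow> 'g) \<Rightarrow> 'a2) set \<Rightarrow> ((nat \<Rightarrow> 'g) \<Rightarrow> 'a) set" where
  "lifts G r A A'' j \<alpha> =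
     {f \<in> cochains G r A. push G r j f \<in> cocycles G r A'' \<and> coh_class G r A'' (push G r j f) = \<alpha>}"

end

theory Submission
  imports Defs
begin

text \<open>
  The coboundary is the alternating product of face maps (cochain groups are written
  multiplicatively), so that \<open>d \<circ> d = 0\<close> and the Leibniz rule reduce to identities for faces. If
  \<open>i\<^sub>* u = d f\<close> and \<open>i\<^sub>* v = d g\<close>, then \<open>d u = 0\<close>, \<open>d v = 0\<close> and, the two pairings being compatible,
  \<open>u \<union> d g = d f \<union> v\<close>; by the Leibniz rule the coboundaries of \<open>u \<union> g\<close> and \<open>(-1)\<^sup>r f \<union> v\<close> cancel.
  Two lifts of the same class differ by some \<open>d h + i\<^sub>* a\<close>, and the augmented cochain is additive in
  both arguments. On \<open>(i\<^sub>* a, g)\<close> it is \<open>d (a \<union> g)\<close>, on \<open>(d h, g)\<close> it is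
  \<open>(-1)\<^sup>r d (h \<union> v)\<close>, and similarly in the second argument.
\<close>

section \<open>Alternating products in commutative groups\<close>

text \<open>Formally the augmented cochain is the Leibniz expansion of d(f \<union> g). No pairing
  of A with B is given, however, so f \<union> g does not exist, and the cochain is a cocycle
  without being a coboundary in general. Once one argument comes from its submodule, the product
  exists through one of the two pairings and the cochain is an honest coboundary. The sign (-1)^r
  comes from degrees: u has degree r+1, so d(u \<union> g) is (-1)^(r+1) times u \<union> dg,
  whereas d(f \<union> v) is df \<union> v with sign +1. The form d h + i_* a of a difference of
  lifts comes from surjectivity of j_* on cochains: the coboundary by which the images in A'' differ
  is the image of some d h over A, and what is left is killed by j_* and hence comes from A'. In
  degree 0 there is no h; the only coboundary is the unit, which is why degree 0 is split off
  wherever a coboundary has to be written as d h.\<close>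

definition altprod :: "('a, 'm) monoid_scheme \<Rightarrow> nat \<Rightarrow> (nat \<Rightarrow> 'a) \<Rightarrow> 'a" where
  "altprod G n c = finprod G (\<lambda>i. c i [^]\<^bsub>G\<^esub> ((-1) ^ i :: int)) {..n}"

context comm_group
begin

lemma altprod_closed [simp, intro]:
  assumes "\<And>i. i \<le> n \<Longrightarrow> c i \<in> carrier G"
  shows "altprod G n c \<in> carrier G"
  unfolding altprod_def by (rule finprod_closed) (use assms in auto)

lemma altprod_0:
  assumes "c 0 \<in> carrier G"
  shows "altprod G 0 c = c 0"
  using assms by (simp add: altprod_def)

lemma altprod_Suc:
  assumes "\<And>i. i \<le> Suc n \<Longrightarrow> c i \<in> carrier G"
  shows "altprod G (Suc n) c = c (Suc n) [^] ((-1) ^ Suc n :: int) \<otimes> altprod G n c"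
  unfolding altprod_def by (rule finprod_Suc) (use assms in auto)

lemma altprod_cong:
  assumes "\<And>i. i \<le> n \<Longrightarrow> c i = c' i" and "\<And>i. i \<le> n \<Longrightarrow> c' i \<in> carrier G"
  shows "altprod G n c = altprod G n c'"
  unfolding altprod_def by (rule finprod_cong') (use assms in auto)

lemma altprod_mult:
  assumes "\<And>i. i \<le> n \<Longrightarrow> c i \<in> carrier G" and "\<And>i. i \<le> n \<Longrightarrow> c' i \<in> carrier G"
  shows "altprod G n (\<lambda>i. c i \<otimes> c' i) = altprod G n c \<otimes> altprod G n c'"
  using assms
proof (induction n)
  case 0
  then show ?case by (simp add: altprod_0)
next
  case (Suc n)
  then show ?case by (simp add: altprod_Suc int_pow_distrib m_ac)
qed

text \<open>This carries alternating products through every map needed later: evaluation at a tuple,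
  faces, \<open>push\<close>, the cup product in either argument, and raising to a sign.\<close>

lemma hom_altprod:
  assumes H: "comm_group H" and h: "h \<in> hom G H"
    and c: "\<And>i. i \<le> n \<Longrightarrow> c i \<in> carrier G"
  shows "h (altprod G n c) = altprod H n (\<lambda>i. h (c i))"
proof -
  interpret H: comm_group H by fact
  interpret group_hom G H h by unfold_locales (rule h)
  show ?thesis
    using c
  proof (induction n)
    case 0
    then show ?case by (simp add: altprod_0 H.altprod_0)
  next
    case (Suc n)
    then show ?case
      by (subst altprod_Suc) (auto simp: H.altprod_Suc hom_int_pow)
  qed
qed

lemma int_pow_sign_Suc:
  assumes "x \<in> carrier G"
  shows "x [^] ((-1) ^ Suc n :: int) = inv (x [^] ((-1) ^ n :: int))"
  using assms by (simp add: int_pow_neg)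

lemma int_pow_sign_cancel:
  assumes "x \<in> carrier G"
  shows "x [^] ((-1) ^ n :: int) \<otimes> x [^] ((-1) ^ Suc n :: int) = \<one>"
  using assms by (simp only: int_pow_sign_Suc) simp

text \<open>The combinatorial core of \<open>d \<circ> d = 0\<close>, stated for a cosimplicial identity.\<close>

lemma altprod_altprod_eq_one:
  assumes "\<And>i j. i \<le> Suc n \<Longrightarrow> j \<le> Suc n \<Longrightarrow> c j i \<in> carrier G"
    and "\<And>i j. i < j \<Longrightarrow> j \<le> Suc n \<Longrightarrow> c j i = c i (j - 1)"
  shows "altprod G (Suc n) (\<lambda>j. altprod G n (c j)) = \<one>"
  using assms
proof (induction n)
  case 0
  have "c (Suc 0) 0 = c 0 0" using 0(2)[of 0 "Suc 0"] by simp
  then show ?case using 0(1) by (simp add: altprod_Suc altprod_0 int_pow_neg)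
next
  case (Suc n)
  let ?N = "Suc (Suc n)"
  let ?e = "altprod G (Suc n) (c ?N)"
  have cl: "c j i \<in> carrier G" if "i \<le> ?N" "j \<le> ?N" for i j
    using Suc.prems(1) that by auto
  have IH: "altprod G (Suc n) (\<lambda>j. altprod G n (c j)) = \<one>"
    by (rule Suc.IH) (use Suc.prems in auto)
  \<comment> \<open>The row \<open>?N\<close> of the array and its last column, in rows up to
    \<open>Suc n\<close>, are the same family by the cosimplicial identity but enter with opposite
    signs. Splitting off that column leaves the array of the induction hypothesis.\<close>
  have "altprod G (Suc n) (\<lambda>j. altprod G (Suc n) (c j))
      = altprod G (Suc n) (\<lambda>j. c j (Suc n) [^] ((-1) ^ Suc n :: int) \<otimes> altprod G n (c j))"
    by (intro altprod_cong m_closed int_pow_closed altprod_closed altprod_Suc) (auto intro: cl)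
  also have "\<dots> = altprod G (Suc n) (\<lambda>j. c j (Suc n) [^] ((-1) ^ Suc n :: int))
      \<otimes> altprod G (Suc n) (\<lambda>j. altprod G n (c j))"
    by (intro altprod_mult int_pow_closed altprod_closed) (auto intro: cl)
  also have "\<dots> = altprod G (Suc n) (\<lambda>j. c j (Suc n) [^] ((-1) ^ Suc n :: int))"
    unfolding IH by (intro r_one altprod_closed int_pow_closed) (auto intro: cl)
  also have "\<dots> = altprod G (Suc n) (\<lambda>j. c j (Suc n)) [^] ((-1) ^ Suc n :: int)"
    by (rule hom_altprod[symmetric, OF comm_group_axioms])
      (auto intro: cl simp: hom_def int_pow_distrib simp del: power_Suc)
  also have "altprod G (Suc n) (\<lambda>j. c j (Suc n)) = ?e"
    by (rule altprod_cong) (use Suc.prems(2)[of _ ?N] cl in auto)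
  finally have *: "altprod G (Suc n) (\<lambda>j. altprod G (Suc n) (c j)) = ?e [^] ((-1) ^ Suc n :: int)" .
  have e: "?e \<in> carrier G" by (rule altprod_closed) (auto intro: cl)
  show ?case
    by (subst altprod_Suc)
      (use e * int_pow_sign_cancel[OF e, of "Suc n"] in \<open>auto intro!: cl altprod_closed simp: m_comm simp del: power_Suc\<close>)
qed

text \<open>The combinatorial core of the Leibniz rule: the extra face \<open>a (Suc r) = b 0\<close> occurs on the
  right-hand side twice, with opposite signs.\<close>

lemma altprod_append:
  assumes "\<And>i. i \<le> Suc r \<Longrightarrow> a i \<in> carrier G" and "\<And>k. k \<le> Suc s \<Longrightarrow> b k \<in> carrier G"
    and "a (Suc r) = b 0"
    and "\<And>i. i \<le> r \<Longrightarrow> e i = a i" and "\<And>k. 1 \<le> k \<Longrightarrow> k \<le> Suc s \<Longrightarrow> e (r + k) = b k"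
  shows "altprod G (Suc (r + s)) e
    = altprod G (Suc r) a \<otimes> altprod G (Suc s) b [^] ((-1) ^ r :: int)"
  using assms(2,5)
proof (induction s)
  case 0
  have e: "e (Suc r) = b (Suc 0)" using 0(2)[of "Suc 0"] by simp
  have cl: "altprod G r a \<in> carrier G" "b 0 \<in> carrier G" "b (Suc 0) \<in> carrier G"
    using assms(1) 0(1) by auto
  have swap: "(t \<otimes> w) \<otimes> (y \<otimes> z) = (y \<otimes> w) \<otimes> (t \<otimes> z)"
    if "t \<in> carrier G" "w \<in> carrier G" "y \<in> carrier G" "z \<in> carrier G" for t w y z
    using that by (simp add: m_ac)
  let ?p = "b 0 [^] ((-1) ^ r :: int)" and ?q = "b (Suc 0) [^] ((-1) ^ r :: int)"
  have "altprod G (Suc r) e = inv ?q \<otimes> altprod G r e"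
    by (subst altprod_Suc)
      (use assms(1,4) e cl in \<open>auto simp: le_Suc_eq int_pow_sign_Suc simp del: power_Suc\<close>)
  also have "altprod G r e = altprod G r a"
    by (rule altprod_cong) (use assms(1,4) in auto)
  finally have L: "altprod G (Suc r) e = inv ?q \<otimes> altprod G r a" .
  have R1: "altprod G (Suc r) a = inv ?p \<otimes> altprod G r a"
    by (subst altprod_Suc) (use assms(1,3) cl in \<open>auto simp: int_pow_sign_Suc simp del: power_Suc\<close>)
  have R2: "altprod G (Suc 0) b [^] ((-1) ^ r :: int) = inv ?q \<otimes> ?p"
    by (subst altprod_Suc)
      (use 0(1) cl in \<open>auto simp: altprod_0 int_pow_distrib int_pow_inv int_pow_neg\<close>)
  \<comment> \<open>The common face \<open>a (Suc r) = b 0\<close> has exponent (-1)^(r+1) in the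
    first factor and (-1)^r in the second; regrouping puts \<open>inv ?p\<close> next to
    \<open>?p\<close>.\<close>
  have "inv ?q \<otimes> altprod G r a = (inv ?p \<otimes> altprod G r a) \<otimes> (inv ?q \<otimes> ?p)"
  proof -
    have "(inv ?p \<otimes> altprod G r a) \<otimes> (inv ?q \<otimes> ?p) = (inv ?q \<otimes> altprod G r a) \<otimes> (inv ?p \<otimes> ?p)"
      using swap[of "inv ?p" "altprod G r a" "inv ?q" ?p] cl by simp
    then show ?thesis using cl by simp
  qed
  then show ?case by (simp add: L R1 R2)
next
  case (Suc s)
  have IH: "altprod G (Suc (r + s)) e
    = altprod G (Suc r) a \<otimes> altprod G (Suc s) b [^] ((-1) ^ r :: int)"
    by (rule Suc.IH) (use Suc.prems in auto)
  have ecl: "e i \<in> carrier G" if "i \<le> Suc (Suc (r + s))" for i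
  proof (cases "i \<le> r")
    case True
    then show ?thesis using assms(1,4) by simp
  next
    case False
    then show ?thesis using Suc.prems(1)[of "i - r"] Suc.prems(2)[of "i - r"] that by simp
  qed
  have e: "e (Suc (Suc (r + s))) = b (Suc (Suc s))" using Suc.prems(2)[of "Suc (Suc s)"] by simp
  have cl: "altprod G (Suc r) a \<in> carrier G" "b (Suc (Suc s)) \<in> carrier G"
      "altprod G (Suc s) b \<in> carrier G"
    using assms(1) Suc.prems(1) by auto
  have s: "(b (Suc (Suc s)) [^] ((-1) ^ Suc (Suc s) :: int)) [^] ((-1) ^ r :: int)
      = b (Suc (Suc s)) [^] ((-1) ^ Suc (Suc (r + s)) :: int)"
    using cl by (simp add: int_pow_pow power_add mult.commute)
  have "altprod G (Suc (Suc (r + s))) e = b (Suc (Suc s)) [^] ((-1) ^ Suc (Suc (r + s)) :: int)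
      \<otimes> (altprod G (Suc r) a \<otimes> altprod G (Suc s) b [^] ((-1) ^ r :: int))"
    using altprod_Suc[of "Suc (r + s)" e] ecl IH e by (simp del: power_Suc)
  also have "\<dots> = altprod G (Suc r) a \<otimes> (b (Suc (Suc s)) [^] ((-1) ^ Suc (Suc (r + s)) :: int)
      \<otimes> altprod G (Suc s) b [^] ((-1) ^ r :: int))"
    using cl by (simp add: m_ac del: power_Suc)
  also have "b (Suc (Suc s)) [^] ((-1) ^ Suc (Suc (r + s)) :: int)
      \<otimes> altprod G (Suc s) b [^] ((-1) ^ r :: int) = altprod G (Suc (Suc s)) b [^] ((-1) ^ r :: int)"
    using cl Suc.prems(1) by (subst altprod_Suc) (auto simp: int_pow_distrib s simp del: power_Suc)
  finally show ?case by simp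
qed

end


section \<open>Cochains\<close>

text \<open>A product of two discrete spaces is discrete, so every map out of it is continuous.
  Hence values of cochains may be combined by arbitrary maps between the modules.\<close>

lemma continuous_map_discrete2:
  assumes f: "continuous_map X (discrete_topology S) f"
    and g: "continuous_map X (discrete_topology T) g"
    and h: "\<And>a b. a \<in> S \<Longrightarrow> b \<in> T \<Longrightarrow> h a b \<in> U"
  shows "continuous_map X (discrete_topology U) (\<lambda>x. h (f x) (g x))"
proof -
  have "continuous_map X (discrete_topology (S \<times> T)) (\<lambda>x. (f x, g x))"
    unfolding prod_topology_discrete_topology using f g by (simp add: continuous_map_pairwise o_def)
  moreover have "continuous_map (discrete_topology (S \<times> T)) (discrete_topology U) (\<lambda>(a, b). h a b)"
    using h by auto
  ultimately have "continuous_map X (discrete_topology U) ((\<lambda>(a, b). h a b) \<circ> (\<lambda>x. (f x, g x)))"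
    by (rule continuous_map_compose)
  then show ?thesis by (simp add: o_def)
qed

lemma continuous_map_discrete1:
  assumes "continuous_map X (discrete_topology S) f" and "\<And>a. a \<in> S \<Longrightarrow> h a \<in> U"
  shows "continuous_map X (discrete_topology U) (\<lambda>x. h (f x))"
  using continuous_map_discrete2[OF assms(1) assms(1), of "\<lambda>a _. h a" U] assms(2) by auto

context topological_group
begin

lemma topspace_power_top: "topspace (power_top G r) = tuples G r"
  by (simp add: power_top_def tuples_def topspace_group_top)

lemma cochainsI:
  assumes "f \<in> extensional (tuples G r)"
    and "continuous_map (power_top G r) (discrete_topology (carrier A)) f"
  shows "f \<in> cochains G r A"
  using assms by (simp add: cochains_def)

lemma cochains_value:
  assumes "f \<in> cochains G r A" and "x \<in> tuples G r"
  shows "f x \<in> carrier A"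
  using assms by (auto simp: cochains_def continuous_map_def topspace_power_top)

lemma cochains_continuous:
  "f \<in> cochains G r A \<Longrightarrow> continuous_map (power_top G r) (discrete_topology (carrier A)) f"
  by (simp add: cochains_def)

lemma cochains_eqI:
  assumes "f \<in> cochains G r A" and "g \<in> cochains G r B" and "\<And>x. x \<in> tuples G r \<Longrightarrow> f x = g x"
  shows "f = g"
  using assms by (auto simp: cochains_def intro: extensionalityI)

lemma restrict_cochains:
  assumes "continuous_map (power_top G r) (discrete_topology (carrier A)) f"
  shows "restrict f (tuples G r) \<in> cochains G r A"
  by (rule cochainsI) (use assms in \<open>auto intro: continuous_map_eq simp: topspace_power_top\<close>)

lemma cochain_group_simps [simp]:
  "carrier (cochain_group G r A) = cochains G r A"
  "f \<otimes>\<^bsub>cochain_group G r A\<^esub> g = (\<lambda>x\<in>tuples G r. f x \<oplus>\<^bsub>A\<^esub> g x)"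
  "\<one>\<^bsub>cochain_group G r A\<^esub> = (\<lambda>x\<in>tuples G r. \<zero>\<^bsub>A\<^esub>)"
  by (simp_all add: cochain_group_def)

end

lemma (in discrete_module) cochain_group_comm_group: "comm_group (cochain_group G r A)"
proof (rule comm_groupI, goal_cases)
  case (1 f g)
  then show ?case
    by (auto intro!: restrict_cochains intro: continuous_map_discrete2 dest!: cochains_continuous)
next
  case 2
  then show ?case by (auto intro!: restrict_cochains)
next
  case (3 f g h)
  then show ?case by (auto intro!: restrict_ext simp: A.a_assoc cochains_value)
next
  case (4 f g)
  then show ?case by (auto intro!: restrict_ext simp: A.a_comm cochains_value)
next
  case (5 f)
  then show ?case
    by (auto intro!: cochains_eqI[of _ r A f] restrict_cochains continuous_map_eq[OF cochains_continuous] simp: cochains_value topspace_power_top)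
next
  case (6 f)
  have "restrict (\<lambda>x. \<ominus>\<^bsub>A\<^esub> f x) (tuples G r) \<in> cochains G r A"
    using 6 by (auto intro!: restrict_cochains intro: continuous_map_discrete1 dest!: cochains_continuous)
  then show ?case
    using 6 by (intro bexI[of _ "\<lambda>x\<in>tuples G r. \<ominus>\<^bsub>A\<^esub> f x"])
      (auto intro!: restrict_ext simp: A.l_neg cochains_value)
qed

text \<open>Turns powers and alternating products of cochains into pointwise formulas in A.\<close>

lemma (in discrete_module) eval_hom:
  assumes "x \<in> tuples G r"
  shows "(\<lambda>f. f x) \<in> hom (cochain_group G r A) (add_monoid A)"
  using assms by (auto simp: hom_def cochains_value)

lemma (in discrete_module) cochain_group_pow:
  assumes "f \<in> cochains G r A" and "x \<in> tuples G r"
  shows "(f [^]\<^bsub>cochain_group G r A\<^esub> (k :: int)) x = add_pow A k (f x)"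
  using hom_int_pow[OF eval_hom[OF assms(2)], of f k] assms(1) cochain_group_comm_group
  by (simp add: comm_group.axioms A.a_group add_pow_def)


section \<open>The coboundary as an alternating product of faces\<close>

context topological_group
begin

section \<open>Contractions of tuples: simplicial identities and continuity\<close>

lemma tuples_nth: "x \<in> tuples G r \<Longrightarrow> 1 \<le> k \<Longrightarrow> k \<le> r \<Longrightarrow> x k \<in> carrier G"
  by (auto simp: tuples_def)

lemma contract_in_tuples:
  assumes "x \<in> tuples G (Suc r)"
  shows "contract G i r x \<in> tuples G r"
  unfolding tuples_def contract_def
  by (auto intro!: m_closed tuples_nth[OF assms])

text \<open>The outer faces are instances of \<open>contract\<close> as well.\<close>

lemma shift_eq_contract: "shift 1 r x = contract G 0 r x"
  by (auto simp: shift_def contract_def)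

lemma restrict_eq_contract: "restrict x {1..r} = contract G (Suc r) r x"
  by (auto simp: contract_def)

text \<open>The simplicial identity of the bar construction. Associativity enters only for adjacent
  contractions, \<open>j = i + 1\<close>, at the position where three consecutive entries are
  merged; everywhere else both sides pick the same entries.\<close>

lemma contract_contract:
  assumes "x \<in> tuples G (Suc (Suc r))" and "i < j" and "j \<le> Suc (Suc r)"
  shows "contract G i r (contract G j (Suc r) x) = contract G (j - 1) r (contract G i (Suc r) x)"
proof
  fix k
  have cl: "x l \<in> carrier G" if "1 \<le> l" "l \<le> Suc (Suc r)" for l
    using tuples_nth[OF assms(1)] that by simp
  consider "k \<notin> {1..r}" | "k \<in> {1..r}" "k < i" | "k \<in> {1..r}" "k = i" "i < j - 1"
    | "k \<in> {1..r}" "k = i" "i = j - 1" | "k \<in> {1..r}" "i < k" "k < j - 1"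
    | "k \<in> {1..r}" "i < k" "k = j - 1" | "k \<in> {1..r}" "j - 1 < k"
    using assms(2) by linarith
  then show "contract G i r (contract G j (Suc r) x) k
      = contract G (j - 1) r (contract G i (Suc r) x) k"
  proof cases
    case 4
    then have "j = Suc k" using assms(2) by simp
    then show ?thesis using 4 cl by (simp add: contract_def m_assoc)
  next
    case 6
    then have "j = Suc k" using assms(2) by simp
    then show ?thesis using 6(1,2) by (simp add: contract_def)
  qed (use assms in \<open>auto simp: contract_def\<close>)
qed

lemma continuous_map_nth:
  assumes "1 \<le> k" and "k \<le> r"
  shows "continuous_map (power_top G r) (group_top G) (\<lambda>x. x k)"
  unfolding power_top_def by (rule continuous_map_product_projection) (use assms in auto)

lemma continuous_map_times:
  assumes "continuous_map X (group_top G) f" and "continuous_map X (group_top G) g"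
  shows "continuous_map X (group_top G) (\<lambda>x. f x \<otimes> g x)"
  using continuous_map_compose[OF _ continuous_mult, of X "\<lambda>x. (f x, g x)"] assms
  by (simp add: continuous_map_pairwise o_def)

lemma continuous_map_power_topI:
  assumes "\<And>x. x \<in> topspace X \<Longrightarrow> f x \<in> extensional {1..r}"
    and "\<And>k. 1 \<le> k \<Longrightarrow> k \<le> r \<Longrightarrow> continuous_map X (group_top G) (\<lambda>x. f x k)"
  shows "continuous_map X (power_top G r) f"
  unfolding power_top_def using assms by (auto simp: continuous_map_componentwise)

lemma continuous_map_contract:
  "continuous_map (power_top G (Suc r)) (power_top G r) (contract G i r)"
proof (rule continuous_map_power_topI)
  fix k :: nat
  assume k: "1 \<le> k" "k \<le> r"
  consider "k < i" | "k = i" | "i < k" by linarith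
  then show "continuous_map (power_top G (Suc r)) (group_top G) (\<lambda>x. contract G i r x k)"
    by cases (use k in \<open>auto simp: contract_def intro!: continuous_map_nth continuous_map_times\<close>)
qed (simp add: contract_def)

end

text \<open>In the coboundary only the term 0 involves the action. Letting the other terms act by
  the unit gives all faces one formula, so that a single identity for scalars covers all
  cases.\<close>

definition face_scalar :: "'g top_group \<Rightarrow> nat \<Rightarrow> (nat \<Rightarrow> 'g) \<Rightarrow> 'g" where
  "face_scalar G i x = (if i = 0 then x 1 else \<one>\<^bsub>G\<^esub>)"

definition face ::
    "'g top_group \<Rightarrow> nat \<Rightarrow> ('g, 'a) module \<Rightarrow> nat \<Rightarrow> ((nat \<Rightarrow> 'g) \<Rightarrow> 'a) \<Rightarrow> (nat \<Rightarrow> 'g) \<Rightarrow> 'a" where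
  "face G r A i f = (\<lambda>x\<in>tuples G (Suc r). face_scalar G i x \<odot>\<^bsub>A\<^esub> f (contract G i r x))"

lemma (in topological_group) face_scalar_closed:
  "x \<in> tuples G (Suc r) \<Longrightarrow> face_scalar G i x \<in> carrier G"
  by (simp add: face_scalar_def tuples_nth)

text \<open>For \<open>i = 0\<close> and \<open>j = 1\<close> both sides are the product of the
  first two entries. For \<open>i = 0\<close> and larger \<open>j\<close> both are the first entry,
  and for positive \<open>i\<close> all scalars are the unit.\<close>

lemma (in topological_group) face_scalar_contract:
  assumes "x \<in> tuples G (Suc (Suc r))" and "i < j"
  shows "face_scalar G j x \<otimes> face_scalar G i (contract G j (Suc r) x)
    = face_scalar G i x \<otimes> face_scalar G (j - 1) (contract G i (Suc r) x)"
  using assms(2) tuples_nth[OF assms(1), of 1] tuples_nth[OF assms(1), of 2]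
  by (cases "j = 1") (auto simp: face_scalar_def contract_def numeral_2_eq_2)

context discrete_module
begin

lemma continuous_map_act:
  assumes "continuous_map X (group_top G) u" and "continuous_map X (discrete_topology (carrier A)) f"
  shows "continuous_map X (discrete_topology (carrier A)) (\<lambda>x. u x \<odot>\<^bsub>A\<^esub> f x)"
  using continuous_map_compose[OF _ act_continuous, of X "\<lambda>x. (u x, f x)"] assms
  by (simp add: continuous_map_pairwise o_def)

lemma face_closed:
  assumes "f \<in> cochains G r A"
  shows "face G r A i f \<in> cochains G (Suc r) A"
  unfolding face_def
proof (intro restrict_cochains continuous_map_act)
  show "continuous_map (power_top G (Suc r)) (group_top G) (face_scalar G i)"
    by (cases "i = 0")
      (auto simp: face_scalar_def[abs_def] topspace_group_top intro: continuous_map_nth)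
  show "continuous_map (power_top G (Suc r)) (discrete_topology (carrier A))
      (\<lambda>x. f (contract G i r x))"
    using continuous_map_compose[OF continuous_map_contract cochains_continuous[OF assms]]
    by (simp add: o_def)
qed

lemma face_hom: "face G r A i \<in> hom (cochain_group G r A) (cochain_group G (Suc r) A)"
proof (rule homI)
  fix f g assume "f \<in> carrier (cochain_group G r A)" "g \<in> carrier (cochain_group G r A)"
  then show "face G r A i (f \<otimes>\<^bsub>cochain_group G r A\<^esub> g)
      = face G r A i f \<otimes>\<^bsub>cochain_group G (Suc r) A\<^esub> face G r A i g"
    by (auto simp: face_def act_add face_scalar_closed cochains_value contract_in_tuples
        intro!: restrict_ext)
qed (simp add: face_closed)

text \<open>Combines the identities for tuples and for scalars into the hypothesis of
  \<open>altprod_altprod_eq_one\<close>, with \<open>c j i\<close> the face \<open>j\<close> of the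
  face \<open>i\<close> of \<open>f\<close>.\<close>

lemma face_face:
  assumes f: "f \<in> cochains G r A" and ij: "i < j" "j \<le> Suc (Suc r)"
  shows "face G (Suc r) A j (face G r A i f) = face G (Suc r) A i (face G r A (j - 1) f)"
proof (rule cochains_eqI[of _ "Suc (Suc r)" A _ A])
  fix x assume x: "x \<in> tuples G (Suc (Suc r))"
  have *: "face G (Suc r) A l (face G r A m f) x = (face_scalar G l x
      \<otimes>\<^bsub>G\<^esub> face_scalar G m (contract G l (Suc r) x)) \<odot>\<^bsub>A\<^esub> f (contract G m r (contract G l (Suc r) x))" for l m
    using x f by (simp add: face_def contract_in_tuples act_mult face_scalar_closed[of _ "Suc r"]
        face_scalar_closed[of _ r] cochains_value)
  show "face G (Suc r) A j (face G r A i f) x = face G (Suc r) A i (face G r A (j - 1) f) x"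
    unfolding * using contract_contract[OF x ij] face_scalar_contract[OF x ij(1)] by simp
qed (use f in \<open>auto intro: face_closed\<close>)

text \<open>Evaluation at a tuple turns the product of faces into a sum in A. Splitting off its
  terms 0 and \<open>r + 1\<close>, which \<open>coboundary\<close> writes separately, leaves the
  sum over \<open>{1..r}\<close>, where the scalars are the unit.\<close>

lemma coboundary_eq_altprod:
  assumes f: "f \<in> cochains G r A"
  shows "coboundary G r A f = altprod (cochain_group G (Suc r) A) (Suc r) (\<lambda>i. face G r A i f)"
proof -
  interpret K: comm_group "cochain_group G (Suc r) A" by (rule cochain_group_comm_group)
  have cl: "altprod (cochain_group G (Suc r) A) (Suc r) (\<lambda>i. face G r A i f) \<in> cochains G (Suc r) A"
    using K.altprod_closed[of "Suc r" "\<lambda>i. face G r A i f"] face_closed[OF f] by simp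
  have "coboundary G r A f x = altprod (cochain_group G (Suc r) A) (Suc r) (\<lambda>i. face G r A i f) x"
    if x: "x \<in> tuples G (Suc r)" for x
  proof -
    let ?c = "\<lambda>i. face G r A i f x"
    have c: "?c i \<in> carrier A" for i
      using cochains_value[OF face_closed[OF f] x] .
    have c0: "?c 0 = x 1 \<odot>\<^bsub>A\<^esub> f (shift 1 r x)"
      unfolding shift_eq_contract using x by (simp add: face_def face_scalar_def)
    have cS: "?c i = f (contract G i r x)" if "i \<noteq> 0" for i
      using x f that
      by (simp add: face_def face_scalar_def act_one cochains_value contract_in_tuples)
    have "altprod (cochain_group G (Suc r) A) (Suc r) (\<lambda>i. face G r A i f) x
        = altprod (add_monoid A) (Suc r) ?c"
      by (rule K.hom_altprod[OF A.a_comm_group eval_hom[OF x]]) (simp add: face_closed f)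
    also have "\<dots> = (\<Oplus>\<^bsub>A\<^esub>i\<in>{..Suc r}. add_pow A ((-1) ^ i :: int) (?c i))"
      by (simp add: altprod_def finsum_def add_pow_def)
    also have "\<dots> = add_pow A ((-1) ^ Suc r :: int) (?c (Suc r))
        \<oplus>\<^bsub>A\<^esub> (\<Oplus>\<^bsub>A\<^esub>i\<in>{..r}. add_pow A ((-1) ^ i :: int) (?c i))"
      by (rule A.finsum_Suc) (use c in auto)
    also have "{..r} = insert 0 {1..r}" by auto
    also have "(\<Oplus>\<^bsub>A\<^esub>i\<in>insert 0 {1..r}. add_pow A ((-1) ^ i :: int) (?c i))
        = ?c 0 \<oplus>\<^bsub>A\<^esub> (\<Oplus>\<^bsub>A\<^esub>i\<in>{1..r}. add_pow A ((-1) ^ i :: int) (?c i))"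
      by (subst A.finsum_insert) (use c in \<open>auto simp: A.add.int_pow_1\<close>)
    also have "(\<Oplus>\<^bsub>A\<^esub>i\<in>{1..r}. add_pow A ((-1) ^ i :: int) (?c i))
        = (\<Oplus>\<^bsub>A\<^esub>i\<in>{1..r}. add_pow A ((-1) ^ i :: int) (f (contract G i r x)))"
      by (rule A.finsum_cong') (use x f in \<open>auto simp: cS cochains_value contract_in_tuples\<close>)
    finally have "altprod (cochain_group G (Suc r) A) (Suc r) (\<lambda>i. face G r A i f) x =
        add_pow A ((-1) ^ Suc r :: int) (?c (Suc r)) \<oplus>\<^bsub>A\<^esub> (?c 0
        \<oplus>\<^bsub>A\<^esub> (\<Oplus>\<^bsub>A\<^esub>i\<in>{1..r}. add_pow A ((-1) ^ i :: int) (f (contract G i r x))))" .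
    also have "\<dots> = ?c 0
        \<oplus>\<^bsub>A\<^esub> (\<Oplus>\<^bsub>A\<^esub>i\<in>{1..r}. add_pow A ((-1) ^ i :: int) (f (contract G i r x)))
        \<oplus>\<^bsub>A\<^esub> add_pow A ((-1) ^ Suc r :: int) (?c (Suc r))"
      using c x f by (intro A.a_comm) (auto simp: cochains_value contract_in_tuples)
    also have "\<dots> = coboundary G r A f x"
      using x unfolding c0 coboundary_def
      by (simp add: cS restrict_eq_contract[symmetric] del: power_Suc)
    finally show ?thesis ..
  qed
  then show ?thesis
    using cl by (intro extensionalityI[of _ "tuples G (Suc r)"])
      (auto simp: coboundary_def cochains_def simp del: power_Suc)
qed

lemma coboundary_closed:
  assumes "f \<in> cochains G r A"
  shows "coboundary G r A f \<in> cochains G (Suc r) A"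
  using comm_group.altprod_closed[OF cochain_group_comm_group, of "Suc r" "\<lambda>i. face G r A i f"]
  by (simp add: coboundary_eq_altprod assms face_closed)

lemma coboundary_hom:
  "coboundary G r A \<in> hom (cochain_group G r A) (cochain_group G (Suc r) A)"
proof (rule homI)
  interpret K: comm_group "cochain_group G r A" by (rule cochain_group_comm_group)
  interpret K': comm_group "cochain_group G (Suc r) A" by (rule cochain_group_comm_group)
  fix f g assume fg: "f \<in> carrier (cochain_group G r A)" "g \<in> carrier (cochain_group G r A)"
  have "coboundary G r A (f \<otimes>\<^bsub>cochain_group G r A\<^esub> g)
      = altprod (cochain_group G (Suc r) A) (Suc r)
          (\<lambda>i. face G r A i (f \<otimes>\<^bsub>cochain_group G r A\<^esub> g))"
    using K.m_closed[OF fg] by (intro coboundary_eq_altprod) (simp only: cochain_group_simps)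
  also have "\<dots> = altprod (cochain_group G (Suc r) A) (Suc r)
          (\<lambda>i. face G r A i f \<otimes>\<^bsub>cochain_group G (Suc r) A\<^esub> face G r A i g)"
    using hom_mult[OF face_hom fg] by presburger
  also have "\<dots> = coboundary G r A f \<otimes>\<^bsub>cochain_group G (Suc r) A\<^esub> coboundary G r A g"
    using fg by (subst K'.altprod_mult)
      (auto simp: coboundary_eq_altprod face_closed simp del: cochain_group_simps(2))
  finally show "coboundary G r A (f \<otimes>\<^bsub>cochain_group G r A\<^esub> g)
      = coboundary G r A f \<otimes>\<^bsub>cochain_group G (Suc r) A\<^esub> coboundary G r A g" .
qed (simp add: coboundary_closed)

lemma coboundary_coboundary:
  assumes f: "f \<in> cochains G r A"
  shows "coboundary G (Suc r) A (coboundary G r A f) = \<one>\<^bsub>cochain_group G (Suc (Suc r)) A\<^esub>"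
proof -
  interpret K: comm_group "cochain_group G (Suc r) A" by (rule cochain_group_comm_group)
  interpret K': comm_group "cochain_group G (Suc (Suc r)) A" by (rule cochain_group_comm_group)
  have "coboundary G (Suc r) A (coboundary G r A f)
      = altprod (cochain_group G (Suc (Suc r)) A) (Suc (Suc r))
          (\<lambda>j. face G (Suc r) A j (coboundary G r A f))"
    by (rule coboundary_eq_altprod) (rule coboundary_closed[OF f])
  also have "\<dots> = altprod (cochain_group G (Suc (Suc r)) A) (Suc (Suc r))
      (\<lambda>j. altprod (cochain_group G (Suc (Suc r)) A) (Suc r)
        (\<lambda>i. face G (Suc r) A j (face G r A i f)))"
    unfolding coboundary_eq_altprod[OF f]
    by (intro K'.altprod_cong K.hom_altprod K'.altprod_closed face_hom K'.comm_group_axioms)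
      (auto intro: face_closed f)
  also have "\<dots> = \<one>\<^bsub>cochain_group G (Suc (Suc r)) A\<^esub>"
    by (rule K'.altprod_altprod_eq_one) (use face_face[OF f] in \<open>auto intro: face_closed f\<close>)
  finally show ?thesis .
qed

end


section \<open>Functoriality\<close>

lemma (in topological_group) push_closed:
  assumes "f \<in> cochains G r A" and "\<And>a. a \<in> carrier A \<Longrightarrow> h a \<in> carrier B"
  shows "push G r h f \<in> cochains G r B"
  unfolding push_def compose_def
  by (rule restrict_cochains, rule continuous_map_discrete1[OF cochains_continuous])
    (use assms in auto)

lemma (in topological_group) push_apply: "x \<in> tuples G r \<Longrightarrow> push G r h f x = h (f x)"
  by (simp add: push_def compose_def)

lemma (in topological_group) push_hom:
  assumes "h \<in> hom (add_monoid A) (add_monoid B)"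
  shows "push G r h \<in> hom (cochain_group G r A) (cochain_group G r B)"
proof (rule homI)
  fix f assume "f \<in> carrier (cochain_group G r A)"
  then show "push G r h f \<in> carrier (cochain_group G r B)"
    using assms by (auto intro!: push_closed simp: hom_def)
next
  fix f g assume "f \<in> carrier (cochain_group G r A)" "g \<in> carrier (cochain_group G r A)"
  then show "push G r h (f \<otimes>\<^bsub>cochain_group G r A\<^esub> g)
      = push G r h f \<otimes>\<^bsub>cochain_group G r B\<^esub> push G r h g"
    using hom_mult[OF assms]
    by (auto simp: push_def compose_def cochains_value intro!: restrict_ext)
qed

text \<open>Equivariance makes \<open>push\<close> commute with each single face, and being a
  homomorphism it then commutes with their alternating product.\<close>

lemma push_coboundary:
  assumes A: "discrete_module G A" and B: "discrete_module G B"
    and h: "h \<in> hom (add_monoid A) (add_monoid B)" and e: "equivariant G A B h"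
    and f: "f \<in> cochains G r A"
  shows "push G (Suc r) h (coboundary G r A f) = coboundary G r B (push G r h f)"
proof -
  interpret A: discrete_module G A by fact
  interpret B: discrete_module G B by fact
  have pf: "push G r h f \<in> cochains G r B"
    using hom_in_carrier[OF A.push_hom[OF h]] f by simp
  have "push G (Suc r) h (face G r A i f) = face G r B i (push G r h f)" for i
    using f e unfolding face_def push_def compose_def
    by (auto intro!: restrict_ext
        simp: equivariant_def A.cochains_value A.contract_in_tuples A.face_scalar_closed)
  then show ?thesis
    unfolding A.coboundary_eq_altprod[OF f] B.coboundary_eq_altprod[OF pf]
    by (subst comm_group.hom_altprod[OF A.cochain_group_comm_group B.cochain_group_comm_group
          A.push_hom[OF h]]) (auto intro: A.face_closed f)
qed


section \<open>Short exact sequences of cochain groups\<close>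

locale short_exact_modules =
  fixes G :: "'g top_group" and A' :: "('g, 'a1) module" and A :: "('g, 'a) module"
    and A'' :: "('g, 'a2) module" and i j
  assumes short_exact: "short_exact G A' A A'' i j"
begin

sublocale A': discrete_module G A' using short_exact by (simp add: short_exact_def)
sublocale A: discrete_module G A using short_exact by (simp add: short_exact_def)
sublocale A'': discrete_module G A'' using short_exact by (simp add: short_exact_def)

lemma i_hom: "i \<in> hom (add_monoid A') (add_monoid A)"
  using short_exact by (simp add: short_exact_def mon_def)

lemma j_hom: "j \<in> hom (add_monoid A) (add_monoid A'')"
  using short_exact by (simp add: short_exact_def epi_def)

lemma i_equivariant: "equivariant G A' A i" and j_equivariant: "equivariant G A A'' j"
  using short_exact by (simp_all add: short_exact_def)

lemma i_inj: "inj_on i (carrier A')"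
  using short_exact by (simp add: short_exact_def mon_def)

lemma j_surj: "j ` carrier A = carrier A''"
  using short_exact by (simp add: short_exact_def epi_def)

lemma exact: "i ` carrier A' = {a \<in> carrier A. j a = \<zero>\<^bsub>A''\<^esub>}"
  using short_exact by (simp add: short_exact_def Coset.kernel_def)

lemma i_closed: "a \<in> carrier A' \<Longrightarrow> i a \<in> carrier A"
  using exact by auto

lemma j_closed: "a \<in> carrier A \<Longrightarrow> j a \<in> carrier A''"
  using j_surj by auto

lemma push_i_closed: "u \<in> cochains G r A' \<Longrightarrow> push G r i u \<in> cochains G r A"
  by (erule A'.push_closed) (rule i_closed)

lemma push_j_closed: "f \<in> cochains G r A \<Longrightarrow> push G r j f \<in> cochains G r A''"
  by (erule A'.push_closed) (rule j_closed)

lemma push_i_inj: "inj_on (push G r i) (cochains G r A')"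
proof (rule inj_onI)
  fix u v assume uv: "u \<in> cochains G r A'" "v \<in> cochains G r A'" "push G r i u = push G r i v"
  show "u = v"
  proof (rule A'.cochains_eqI[OF uv(1,2)])
    fix x assume x: "x \<in> tuples G r"
    have "i (u x) = i (v x)" using uv(3) A'.push_apply[OF x] by metis
    then show "u x = v x"
      using i_inj uv(1,2) x by (meson A'.cochains_value inj_onD)
  qed
qed

lemma push_j_push_i:
  assumes "u \<in> cochains G r A'"
  shows "push G r j (push G r i u) = \<one>\<^bsub>cochain_group G r A''\<^esub>"
  unfolding push_def compose_def A'.cochain_group_simps
  by (rule restrict_ext) (use exact A'.cochains_value[OF assms] in auto)

lemma push_i_ex:
  assumes f: "f \<in> cochains G r A" and "push G r j f = \<one>\<^bsub>cochain_group G r A''\<^esub>"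
  obtains u where "u \<in> cochains G r A'" and "push G r i u = f"
proof
  \<comment> \<open>The inverse of \<open>i\<close> on its image, extended by zero:
    \<open>push_closed\<close> requires values in \<open>carrier A'\<close> on all of
    \<open>carrier A\<close>, not only where \<open>f\<close> takes its values.\<close>
  define h where "h a = (if a \<in> i ` carrier A' then inv_into (carrier A') i a else \<zero>\<^bsub>A'\<^esub>)" for a
  have h: "h a \<in> carrier A'" for a
    by (auto simp: h_def inv_into_into)
  have ih: "i (h (f x)) = f x" if x: "x \<in> tuples G r" for x
  proof -
    have "j (f x) = \<zero>\<^bsub>A''\<^esub>"
      using assms(2) A'.push_apply[OF x, of j f] x by simp
    then have "f x \<in> i ` carrier A'" using exact A'.cochains_value[OF f x] by simp
    then show ?thesis by (simp add: h_def f_inv_into_f)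
  qed
  show u: "push G r h f \<in> cochains G r A'" by (rule A'.push_closed[OF f]) (rule h)
  show "push G r i (push G r h f) = f"
    by (rule A'.cochains_eqI[OF push_i_closed[OF u] f]) (simp add: A'.push_apply ih)
qed

text \<open>A set-theoretic section of \<open>j\<close> suffices. It need be neither additive nor
  equivariant, and it is continuous because the modules are discrete.\<close>

lemma push_j_ex:
  assumes f: "f \<in> cochains G r A''"
  obtains e where "e \<in> cochains G r A" and "push G r j e = f"
proof
  let ?h = "inv_into (carrier A) j"
  show e: "push G r ?h f \<in> cochains G r A"
    by (rule A'.push_closed[OF f]) (metis inv_into_into j_surj)
  show "push G r j (push G r ?h f) = f"
    by (rule A'.cochains_eqI[OF push_j_closed[OF e] f])
      (metis A'.cochains_value A'.push_apply f f_inv_into_f j_surj)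
qed

lemma push_i_coboundary:
  "u \<in> cochains G r A' \<Longrightarrow> push G (Suc r) i (coboundary G r A' u) = coboundary G r A (push G r i u)"
  by (rule push_coboundary[OF A'.discrete_module_axioms A.discrete_module_axioms i_hom i_equivariant])

lemma push_j_coboundary:
  "f \<in> cochains G r A \<Longrightarrow> push G (Suc r) j (coboundary G r A f) = coboundary G r A'' (push G r j f)"
  by (rule push_coboundary[OF A.discrete_module_axioms A''.discrete_module_axioms j_hom j_equivariant])

end


section \<open>Cup products and the Leibniz rule\<close>

context topological_group
begin

section \<open>Products, initial segments and final segments of contracted tuples\<close>

lemma tuple_prod_closed:
  assumes "x \<in> tuples G n" and "r \<le> n"
  shows "tuple_prod G r x \<in> carrier G"
  using assms(2) by (induction r) (auto intro!: m_closed tuples_nth[OF assms(1)])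

lemma continuous_map_tuple_prod:
  "r \<le> n \<Longrightarrow> continuous_map (power_top G n) (group_top G) (tuple_prod G r)"
proof (induction r)
  case 0
  then show ?case by (simp add: topspace_group_top tuple_prod.simps(1)[abs_def])
next
  case (Suc r)
  then show ?case
    by (simp add: tuple_prod.simps(2)[abs_def] continuous_map_times continuous_map_nth)
qed

lemma tuple_prod_contract_less:
  "r < i \<Longrightarrow> r \<le> n \<Longrightarrow> tuple_prod G r (contract G i n x) = tuple_prod G r x"
  by (induction r) (auto simp: contract_def)

text \<open>Merging two of the first \<open>r + 1\<close> entries does not change their product; for
  \<open>i = 0\<close> the first entry is dropped and the scalar restores it.\<close>

lemma tuple_prod_contract_ge:
  assumes "x \<in> tuples G (Suc n)"
  shows "i \<le> r \<Longrightarrow> r \<le> n \<Longrightarrow>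
    face_scalar G i x \<otimes> tuple_prod G r (contract G i n x) = tuple_prod G (Suc r) x"
proof (induction r)
  case 0
  then show ?case using tuples_nth[OF assms, of 1] by (simp add: face_scalar_def)
next
  case (Suc r)
  have cl: "x (Suc r) \<in> carrier G" "x (Suc (Suc r)) \<in> carrier G" "tuple_prod G r x \<in> carrier G"
      "tuple_prod G r (contract G i n x) \<in> carrier G" "face_scalar G i x \<in> carrier G"
    using tuples_nth[OF assms] tuple_prod_closed[OF assms, of r] Suc.prems
      tuple_prod_closed[OF contract_in_tuples[OF assms], of r] face_scalar_closed[OF assms] by auto
  show ?case
  proof (cases "i \<le> r")
    case True
    have "contract G i n x (Suc r) = x (Suc (Suc r))"
      using True Suc.prems by (simp add: contract_def)
    then show ?thesis
      using Suc.IH[OF True] Suc.prems cl by (simp add: m_assoc[symmetric])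
  next
    case False
    then have i: "i = Suc r" using Suc.prems by simp
    have "contract G i n x (Suc r) = x (Suc r) \<otimes> x (Suc (Suc r))"
      using i Suc.prems by (simp add: contract_def)
    then show ?thesis
      using i Suc.prems cl by (simp add: m_assoc tuple_prod_contract_less face_scalar_def)
  qed
qed

lemma restrict_in_tuples: "x \<in> tuples G n \<Longrightarrow> r \<le> n \<Longrightarrow> restrict x {1..r} \<in> tuples G r"
  by (auto simp: tuples_def)

lemma shift_in_tuples: "x \<in> tuples G n \<Longrightarrow> r + s \<le> n \<Longrightarrow> shift r s x \<in> tuples G s"
  by (auto simp: tuples_def shift_def)

lemma restrict_contract_ge:
  "i \<le> r \<Longrightarrow> r \<le> n \<Longrightarrow> restrict (contract G i n x) {1..r} = contract G i r (restrict x {1..Suc r})"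
  by (auto simp: contract_def)

lemma restrict_contract_less:
  "r < i \<Longrightarrow> r \<le> n \<Longrightarrow> restrict (contract G i n x) {1..r} = restrict x {1..r}"
  by (auto simp: contract_def)

lemma shift_contract_ge:
  "i \<le> r \<Longrightarrow> shift r s (contract G i (r + s) x) = shift (Suc r) s x"
  by (auto simp: contract_def shift_def)

lemma shift_contract: "shift r s (contract G (r + k) (r + s) x) = contract G k s (shift r (Suc s) x)"
  by (auto simp: contract_def shift_def)

lemma face_scalar_restrict: "face_scalar G i (restrict x {1..Suc r}) = face_scalar G i x"
  by (simp add: face_scalar_def)

end

locale module_pairing =
  A: discrete_module G A + B: discrete_module G B + C: discrete_module G C
  for G :: "'g top_group" and A :: "('g, 'a) module" and B :: "('g, 'b) module"
    and C :: "('g, 'c) module" +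
  fixes p :: "'a \<Rightarrow> 'b \<Rightarrow> 'c"
  assumes bilinear: "G_bilinear G A B C p"
begin

lemma p_closed: "a \<in> carrier A \<Longrightarrow> b \<in> carrier B \<Longrightarrow> p a b \<in> carrier C"
  and p_add_left: "a \<in> carrier A \<Longrightarrow> a' \<in> carrier A \<Longrightarrow> b \<in> carrier B
    \<Longrightarrow> p (a \<oplus>\<^bsub>A\<^esub> a') b = p a b \<oplus>\<^bsub>C\<^esub> p a' b"
  and p_add_right: "a \<in> carrier A \<Longrightarrow> b \<in> carrier B \<Longrightarrow> b' \<in> carrier B
    \<Longrightarrow> p a (b \<oplus>\<^bsub>B\<^esub> b') = p a b \<oplus>\<^bsub>C\<^esub> p a b'"
  and p_act: "x \<in> carrier G \<Longrightarrow> a \<in> carrier A \<Longrightarrow> b \<in> carrier B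
    \<Longrightarrow> x \<odot>\<^bsub>C\<^esub> p a b = p (x \<odot>\<^bsub>A\<^esub> a) (x \<odot>\<^bsub>B\<^esub> b)"
  using bilinear by (simp_all add: G_bilinear_def)

text \<open>The twist in the second argument is harmless: the product of the first \<open>r\<close>
  entries is continuous and the action is jointly continuous, so both arguments of \<open>p\<close>
  are continuous into discrete spaces.\<close>

lemma cup_closed:
  assumes f: "f \<in> cochains G r A" and g: "g \<in> cochains G s B"
  shows "cup G r s B p f g \<in> cochains G (r + s) C"
  unfolding cup_def
proof (rule A.restrict_cochains, rule continuous_map_discrete2[where h = p and S = "carrier A" and T = "carrier B"], goal_cases)
  case 1
  have "continuous_map (power_top G (r + s)) (power_top G r) (\<lambda>x. restrict x {1..r})"
    by (rule A.continuous_map_power_topI) (auto intro: A.continuous_map_nth)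
  from continuous_map_compose[OF this A.cochains_continuous[OF f]] show ?case
    by (simp add: o_def)
next
  case 2
  have "continuous_map (power_top G (r + s)) (power_top G s) (shift r s)"
    by (rule A.continuous_map_power_topI) (auto simp: shift_def intro: A.continuous_map_nth)
  from continuous_map_compose[OF this A.cochains_continuous[OF g]] show ?case
    by (intro B.continuous_map_act A.continuous_map_tuple_prod) (simp_all add: o_def)
qed (rule p_closed)

lemma cup_args:
  assumes "f \<in> cochains G r A" and "g \<in> cochains G s B" and "x \<in> tuples G (r + s)"
  shows "f (restrict x {1..r}) \<in> carrier A"
    and "tuple_prod G r x \<odot>\<^bsub>B\<^esub> g (shift r s x) \<in> carrier B"
    and "g (shift r s x) \<in> carrier B" and "tuple_prod G r x \<in> carrier G"
proof -
  show "g (shift r s x) \<in> carrier B" and "tuple_prod G r x \<in> carrier G"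
    using A.cochains_value[OF assms(2) A.shift_in_tuples[OF assms(3)]]
      A.tuple_prod_closed[OF assms(3)] by simp_all
  then show "tuple_prod G r x \<odot>\<^bsub>B\<^esub> g (shift r s x) \<in> carrier B"
    by (rule B.act_closed[rotated])
  show "f (restrict x {1..r}) \<in> carrier A"
    using A.cochains_value[OF assms(1) A.restrict_in_tuples[OF assms(3)]] by simp
qed

lemma cup_hom_left:
  assumes g: "g \<in> cochains G s B"
  shows "(\<lambda>f. cup G r s B p f g) \<in> hom (cochain_group G r A) (cochain_group G (r + s) C)"
proof (rule homI)
  fix f f' assume "f \<in> carrier (cochain_group G r A)" "f' \<in> carrier (cochain_group G r A)"
  then show "cup G r s B p (f \<otimes>\<^bsub>cochain_group G r A\<^esub> f') g
      = cup G r s B p f g \<otimes>\<^bsub>cochain_group G (r + s) C\<^esub> cup G r s B p f' g"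
    using g by (auto simp: cup_def p_add_left cup_args A.restrict_in_tuples
        intro!: restrict_ext simp del: One_nat_def)
qed (use g in \<open>auto intro: cup_closed\<close>)

lemma cup_hom_right:
  assumes f: "f \<in> cochains G r A"
  shows "cup G r s B p f \<in> hom (cochain_group G s B) (cochain_group G (r + s) C)"
proof (rule homI)
  fix g g' assume "g \<in> carrier (cochain_group G s B)" "g' \<in> carrier (cochain_group G s B)"
  then show "cup G r s B p f (g \<otimes>\<^bsub>cochain_group G s B\<^esub> g')
      = cup G r s B p f g \<otimes>\<^bsub>cochain_group G (r + s) C\<^esub> cup G r s B p f g'"
    using f by (auto simp: cup_def p_add_right B.act_add cup_args A.shift_in_tuples
        intro!: restrict_ext simp del: One_nat_def)
qed (use f in \<open>auto intro: cup_closed\<close>)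

text \<open>By equivariance of \<open>p\<close> the scalar of the face acts on both arguments. On
  the first it completes the face of \<open>f\<close>; on the second it completes the product of
  entries in front of \<open>g\<close> by \<open>tuple_prod_contract_ge\<close>.\<close>

lemma face_cup_left:
  assumes f: "f \<in> cochains G r A" and g: "g \<in> cochains G s B" and i: "i \<le> r"
  shows "face G (r + s) C i (cup G r s B p f g) = cup G (Suc r) s B p (face G r A i f) g"
proof -
  have "face_scalar G i x \<odot>\<^bsub>C\<^esub> cup G r s B p f g (contract G i (r + s) x)
      = p (face G r A i f (restrict x {1..Suc r})) (tuple_prod G (Suc r) x \<odot>\<^bsub>B\<^esub> g (shift (Suc r) s x))"
    if x: "x \<in> tuples G (Suc (r + s))" for x
  proof -
    let ?y = "contract G i (r + s) x"
    have y: "?y \<in> tuples G (r + s)" by (rule A.contract_in_tuples[OF x])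
    have s: "face_scalar G i x \<in> carrier G" by (rule A.face_scalar_closed[OF x])
    have "face_scalar G i x \<odot>\<^bsub>C\<^esub> cup G r s B p f g ?y
        = p (face_scalar G i x \<odot>\<^bsub>A\<^esub> f (restrict ?y {1..r}))
            ((face_scalar G i x \<otimes>\<^bsub>G\<^esub> tuple_prod G r ?y) \<odot>\<^bsub>B\<^esub> g (shift r s ?y))"
      using y s cup_args[OF f g y] by (simp add: cup_def p_act B.act_mult del: One_nat_def)
    then show ?thesis
      using i A.restrict_in_tuples[OF x, of "Suc r"]
      by (simp add: face_def A.tuple_prod_contract_ge[OF x] A.restrict_contract_ge
          A.shift_contract_ge A.face_scalar_restrict
          del: tuple_prod.simps One_nat_def)
  qed
  then show ?thesis
    unfolding face_def[of G "r + s"] cup_def[of G "Suc r"]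
    by (auto intro!: restrict_ext simp del: One_nat_def tuple_prod.simps)
qed

text \<open>The case \<open>k = 0\<close> has to be excluded: that face of \<open>g\<close> acts by
  the entry \<open>x (r + 1)\<close>, and its counterpart is a face of \<open>f\<close>, as
  \<open>cup_face_middle\<close> shows.\<close>

lemma face_cup_right:
  assumes f: "f \<in> cochains G r A" and g: "g \<in> cochains G s B" and k: "1 \<le> k"
  shows "face G (r + s) C (r + k) (cup G r s B p f g) = cup G r (Suc s) B p f (face G s B k g)"
proof -
  have "face_scalar G (r + k) x \<odot>\<^bsub>C\<^esub> cup G r s B p f g (contract G (r + k) (r + s) x)
      = p (f (restrict x {1..r})) (tuple_prod G r x \<odot>\<^bsub>B\<^esub> face G s B k g (shift r (Suc s) x))"
    if x: "x \<in> tuples G (Suc (r + s))" for x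
  proof -
    let ?y = "contract G (r + k) (r + s) x"
    have y: "?y \<in> tuples G (r + s)" by (rule A.contract_in_tuples[OF x])
    have z: "shift r (Suc s) x \<in> tuples G (Suc s)" by (rule A.shift_in_tuples[OF x]) simp
    have "face G s B k g (shift r (Suc s) x) = g (shift r s ?y)"
      using z k cup_args(3)[OF f g y]
      by (simp add: face_def face_scalar_def A.shift_contract B.act_one)
    moreover have "face_scalar G (r + k) x \<odot>\<^bsub>C\<^esub> cup G r s B p f g ?y
        = p (f (restrict ?y {1..r})) (tuple_prod G r ?y \<odot>\<^bsub>B\<^esub> g (shift r s ?y))"
      using y k cup_args[OF f g y]
      by (simp add: face_scalar_def C.act_one p_closed cup_def del: One_nat_def)
    ultimately show ?thesis
      using k by (simp add: A.tuple_prod_contract_less A.restrict_contract_less del: One_nat_def)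
  qed
  then show ?thesis
    unfolding face_def[of G "r + s"] cup_def[of G r "Suc s"]
    by (auto intro!: restrict_ext simp del: One_nat_def)
qed

text \<open>The extra face of \<open>altprod_append\<close>. The last face of \<open>f\<close>
  forgets \<open>x (r + 1)\<close> and the first face of \<open>g\<close> acts by it, so in both
  cases the first \<open>r + 1\<close> entries act on \<open>g\<close>.\<close>

lemma cup_face_middle:
  assumes f: "f \<in> cochains G r A" and g: "g \<in> cochains G s B"
  shows "cup G (Suc r) s B p (face G r A (Suc r) f) g = cup G r (Suc s) B p f (face G s B 0 g)"
proof -
  have "p (face G r A (Suc r) f (restrict x {1..Suc r})) (tuple_prod G (Suc r) x \<odot>\<^bsub>B\<^esub> g (shift (Suc r) s x))
      = p (f (restrict x {1..r})) (tuple_prod G r x \<odot>\<^bsub>B\<^esub> face G s B 0 g (shift r (Suc s) x))"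
    if x: "x \<in> tuples G (Suc (r + s))" for x
  proof -
    have z: "shift r (Suc s) x \<in> tuples G (Suc s)" by (rule A.shift_in_tuples[OF x]) simp
    have w: "restrict x {1..Suc r} \<in> tuples G (Suc r)" by (rule A.restrict_in_tuples[OF x]) simp
    have v: "restrict x {1..r} \<in> tuples G r" by (rule A.restrict_in_tuples[OF x]) simp
    have c: "contract G (Suc r) r (restrict x {1..Suc r}) = restrict x {1..r}"
      by (auto simp: contract_def)
    have d: "contract G 0 s (shift r (Suc s) x) = shift (Suc r) s x"
      by (auto simp: contract_def shift_def)
    have t: "shift (Suc r) s x \<in> tuples G s" by (rule A.shift_in_tuples[OF x]) simp
    have e: "face_scalar G 0 (shift r (Suc s) x) = x (Suc r)"
      by (simp add: face_scalar_def shift_def)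
    have "face G r A (Suc r) f (restrict x {1..Suc r}) = f (restrict x {1..r})"
      using w A.cochains_value[OF f v] by (simp add: face_def face_scalar_def c A.act_one del: One_nat_def)
    moreover have "face G s B 0 g (shift r (Suc s) x) = x (Suc r) \<odot>\<^bsub>B\<^esub> g (shift (Suc r) s x)"
      using z by (simp add: face_def d e del: One_nat_def)
    ultimately show ?thesis
      using A.cochains_value[OF g t] A.tuples_nth[OF x] A.tuple_prod_closed[OF x]
      by (simp add: B.act_mult del: One_nat_def)
  qed
  then show ?thesis
    unfolding cup_def by (auto intro!: restrict_ext simp del: One_nat_def tuple_prod.simps)
qed

text \<open>The three preceding lemmas are the linking hypotheses of \<open>altprod_append\<close>.
  Additivity of the cup product in each argument then turns the two factors into cup products with
  coboundaries.\<close>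

lemma coboundary_cup:
  assumes f: "f \<in> cochains G r A" and g: "g \<in> cochains G s B"
  shows "coboundary G (r + s) C (cup G r s B p f g)
    = cup G (Suc r) s B p (coboundary G r A f) g
      \<otimes>\<^bsub>cochain_group G (Suc (r + s)) C\<^esub>
      cup G r (Suc s) B p f (coboundary G s B g) [^]\<^bsub>cochain_group G (Suc (r + s)) C\<^esub> ((-1) ^ r :: int)"
proof -
  let ?K = "cochain_group G (Suc (r + s)) C"
  interpret K: comm_group ?K by (rule C.cochain_group_comm_group)
  interpret KA: comm_group "cochain_group G (Suc r) A" by (rule A.cochain_group_comm_group)
  interpret KB: comm_group "cochain_group G (Suc s) B" by (rule B.cochain_group_comm_group)
  let ?a = "\<lambda>i. cup G (Suc r) s B p (face G r A i f) g"
  let ?b = "\<lambda>k. cup G r (Suc s) B p f (face G s B k g)"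
  have a: "?a i \<in> carrier ?K" for i
    using cup_closed[OF A.face_closed[OF f] g] by simp
  have b: "?b i \<in> carrier ?K" for i
    using cup_closed[OF f B.face_closed[OF g]] by simp
  have "coboundary G (r + s) C (cup G r s B p f g)
      = altprod ?K (Suc (r + s)) (\<lambda>i. face G (r + s) C i (cup G r s B p f g))"
    by (rule C.coboundary_eq_altprod[OF cup_closed[OF f g]])
  also have "\<dots> = altprod ?K (Suc r) ?a
      \<otimes>\<^bsub>?K\<^esub> altprod ?K (Suc s) ?b [^]\<^bsub>?K\<^esub> ((-1) ^ r :: int)"
    by (rule K.altprod_append)
      (simp_all only: a b face_cup_left[OF f g] face_cup_right[OF f g] cup_face_middle[OF f g])
  also have "altprod ?K (Suc r) ?a = cup G (Suc r) s B p (coboundary G r A f) g"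
    using KA.hom_altprod[OF K.comm_group_axioms, of "\<lambda>f. cup G (Suc r) s B p f g" "Suc r"]
      cup_hom_left[OF g, of "Suc r"]
    by (simp add: A.coboundary_eq_altprod f A.face_closed)
  also have "altprod ?K (Suc s) ?b = cup G r (Suc s) B p f (coboundary G s B g)"
    using KB.hom_altprod[OF K.comm_group_axioms, of "cup G r (Suc s) B p f" "Suc s"]
      cup_hom_right[OF f, of "Suc s"]
    by (simp add: B.coboundary_eq_altprod g B.face_closed)
  finally show ?thesis .
qed

end


section \<open>Cohomology classes\<close>

text \<open>From here on cochain groups are handled by the abstract group laws, which pointwise
  unfolding of the multiplication would block.\<close>

declare (in topological_group) cochain_group_simps(2,3) [simp del]

context discrete_module
begin

sublocale K: comm_group "cochain_group G r A"
  rewrites "carrier (cochain_group G r A) = cochains G r A" for r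
  using cochain_group_comm_group by simp_all

sublocale d: group_hom "cochain_group G r A" "cochain_group G (Suc r) A" "coboundary G r A"
  rewrites "carrier (cochain_group G r A) = cochains G r A"
    and "carrier (cochain_group G (Suc r) A) = cochains G (Suc r) A"
  for r
  by (auto simp: group_hom_def group_hom_axioms_def coboundary_hom
      intro: comm_group.axioms cochain_group_comm_group)

lemma cocycles_iff:
  "f \<in> cocycles G r A \<longleftrightarrow>
    f \<in> cochains G r A \<and> coboundary G r A f = \<one>\<^bsub>cochain_group G (Suc r) A\<^esub>"
  by (simp add: cocycles_def Coset.kernel_def)

lemma coboundaries_subgroup: "subgroup (coboundaries G r A) (cochain_group G r A)"
proof (cases r)
  case 0
  then show ?thesis using K.triv_subgroup[of 0] by (simp add: coboundaries_def)
next
  case (Suc m)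
  then show ?thesis using d.img_is_subgroup[of m] by (simp add: coboundaries_def)
qed

lemma coboundary_in_coboundaries:
  "f \<in> cochains G r A \<Longrightarrow> coboundary G r A f \<in> coboundaries G (Suc r) A"
  by (simp add: coboundaries_def)

text \<open>A coset depends only on the multiplication, which cocycles share with cochains, so the
  coset lemmas of the larger group apply.\<close>

lemma coh_class_eq_coset: "coh_class G r A f = coboundaries G r A #>\<^bsub>cochain_group G r A\<^esub> f"
  by (simp add: coh_class_def r_coset_def cocycle_group_def)

lemma carrier_cohomology: "carrier (cohomology G r A) = coh_class G r A ` cocycles G r A"
  unfolding cohomology_def carrier_FactGroup coh_class_def by (simp add: cocycle_group_def)

lemma coh_class_eqI:
  assumes "f \<in> cochains G r A" and "c \<in> coboundaries G r A"
  shows "coh_class G r A (c \<otimes>\<^bsub>cochain_group G r A\<^esub> f) = coh_class G r A f"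
  unfolding coh_class_eq_coset
  by (rule K.repr_independence[symmetric])
    (use assms coboundaries_subgroup in \<open>auto simp: r_coset_def\<close>)

lemma coh_class_eqE:
  assumes "f \<in> cochains G r A" and "coh_class G r A f = coh_class G r A g"
  obtains c where "c \<in> coboundaries G r A" and "f = c \<otimes>\<^bsub>cochain_group G r A\<^esub> g"
proof -
  have "f \<in> coh_class G r A g"
    using K.rcos_self[OF assms(1) coboundaries_subgroup] assms(2) coh_class_eq_coset by metis
  then show thesis using that by (auto simp: coh_class_eq_coset r_coset_def)
qed

end


section \<open>Lifting cocycles along a short exact sequence\<close>

context short_exact_modules
begin

text \<open>Membership in \<open>lifts\<close> with the class forgotten. Unlike the lifts of a fixed
  class, these cochains are closed under multiplication, as additivity of the augmented cochain
  requires.\<close>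

definition cocycle_lift :: "nat \<Rightarrow> ((nat \<Rightarrow> 'g) \<Rightarrow> 'a) \<Rightarrow> bool" where
  "cocycle_lift r f \<longleftrightarrow> f \<in> cochains G r A \<and> push G r j f \<in> cocycles G r A''"

text \<open>The cochain u of the overview; it represents the image of the class of j_* f under the
  connecting homomorphism.\<close>

definition dlift :: "nat \<Rightarrow> ((nat \<Rightarrow> 'g) \<Rightarrow> 'a) \<Rightarrow> (nat \<Rightarrow> 'g) \<Rightarrow> 'a1" where
  "dlift r f = as_sub G (Suc r) A' i (coboundary G r A f)"

sublocale pi: group_hom "cochain_group G r A'" "cochain_group G r A" "push G r i"
  rewrites "carrier (cochain_group G r A') = cochains G r A'"
    and "carrier (cochain_group G r A) = cochains G r A"
  for r
  by (auto simp: group_hom_def group_hom_axioms_def A'.push_hom[OF i_hom]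
      intro: comm_group.axioms A.cochain_group_comm_group A'.cochain_group_comm_group)

sublocale pj: group_hom "cochain_group G r A" "cochain_group G r A''" "push G r j"
  rewrites "carrier (cochain_group G r A) = cochains G r A"
    and "carrier (cochain_group G r A'') = cochains G r A''"
  for r
  by (auto simp: group_hom_def group_hom_axioms_def A'.push_hom[OF j_hom]
      intro: comm_group.axioms A.cochain_group_comm_group A''.cochain_group_comm_group)

section \<open>The connecting map on cochains\<close>

lemma cocycle_lift_cochains: "cocycle_lift r f \<Longrightarrow> f \<in> cochains G r A"
  by (simp add: cocycle_lift_def)

lemma push_j_coboundary_lift:
  "cocycle_lift r f \<Longrightarrow>
    push G (Suc r) j (coboundary G r A f) = \<one>\<^bsub>cochain_group G (Suc r) A''\<^esub>"
  by (simp add: cocycle_lift_def push_j_coboundary A''.cocycles_iff)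

text \<open>Injectivity of i_* forces the choice made in \<open>as_sub\<close>. Every later value of
  \<open>dlift\<close> is found by exhibiting a preimage.\<close>

lemma dlift_unique:
  assumes "u \<in> cochains G (Suc r) A'" and "push G (Suc r) i u = coboundary G r A f"
  shows "dlift r f = u"
  unfolding dlift_def as_sub_def assms(2)[symmetric]
  by (rule inv_into_f_f[OF push_i_inj assms(1)])

lemma dlift:
  assumes "cocycle_lift r f"
  shows "dlift r f \<in> cochains G (Suc r) A'"
    and "push G (Suc r) i (dlift r f) = coboundary G r A f"
proof -
  obtain u where "u \<in> cochains G (Suc r) A'" "push G (Suc r) i u = coboundary G r A f"
    using push_i_ex[OF A.coboundary_closed push_j_coboundary_lift] assms
    by (auto simp: cocycle_lift_def)
  with dlift_unique show "dlift r f \<in> cochains G (Suc r) A'"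
    and "push G (Suc r) i (dlift r f) = coboundary G r A f" by simp_all
qed

text \<open>Injectivity of i_* reduces the claim to the vanishing of d d f.\<close>

lemma coboundary_dlift:
  assumes f: "cocycle_lift r f"
  shows "coboundary G (Suc r) A' (dlift r f) = \<one>\<^bsub>cochain_group G (Suc (Suc r)) A'\<^esub>"
proof (rule inj_onD[OF push_i_inj])
  show "push G (Suc (Suc r)) i (coboundary G (Suc r) A' (dlift r f))
      = push G (Suc (Suc r)) i \<one>\<^bsub>cochain_group G (Suc (Suc r)) A'\<^esub>"
    using f by (simp add: push_i_coboundary dlift A.coboundary_coboundary cocycle_lift_cochains)
qed (use dlift[OF f] in \<open>auto intro: A'.coboundary_closed\<close>)

lemma cocycle_lift_mult:
  assumes "cocycle_lift r f" and "cocycle_lift r f'"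
  shows "cocycle_lift r (f \<otimes>\<^bsub>cochain_group G r A\<^esub> f')"
  using assms by (simp add: cocycle_lift_def A''.cocycles_iff)

lemma dlift_mult:
  assumes "cocycle_lift r f" and "cocycle_lift r f'"
  shows "dlift r (f \<otimes>\<^bsub>cochain_group G r A\<^esub> f')
    = dlift r f \<otimes>\<^bsub>cochain_group G (Suc r) A'\<^esub> dlift r f'"
  by (rule dlift_unique) (use assms in \<open>simp_all add: dlift cocycle_lift_cochains\<close>)

lemma cocycle_lift_push:
  assumes u: "u \<in> cochains G r A'"
  shows "cocycle_lift r (push G r i u)" and "dlift r (push G r i u) = coboundary G r A' u"
proof -
  show "cocycle_lift r (push G r i u)"
    using u by (simp add: cocycle_lift_def push_i_closed push_j_push_i A''.cocycles_iff)
  show "dlift r (push G r i u) = coboundary G r A' u"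
    by (rule dlift_unique) (use u in \<open>simp_all add: push_i_coboundary A'.coboundary_closed\<close>)
qed

text \<open>Here d c vanishes, in degree 0 because c is the unit, so the unit is a preimage of it
  under i_* as well.\<close>

lemma cocycle_lift_coboundary:
  assumes c: "c \<in> coboundaries G r A"
  shows "cocycle_lift r c" and "dlift r c = \<one>\<^bsub>cochain_group G (Suc r) A'\<^esub>"
proof -
  have cl: "c \<in> cochains G r A"
    using c subgroup.mem_carrier[OF A.coboundaries_subgroup] by simp
  have 0: "coboundary G r A c = \<one>\<^bsub>cochain_group G (Suc r) A\<^esub>"
    using c A.coboundary_coboundary
    by (cases r) (auto simp: coboundaries_def split: if_splits)
  show "cocycle_lift r c"
    using cl by (simp add: cocycle_lift_def A''.cocycles_iff push_j_closed push_j_coboundary[symmetric] 0)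
  show "dlift r c = \<one>\<^bsub>cochain_group G (Suc r) A'\<^esub>"
    by (rule dlift_unique) (simp_all add: 0)
qed

text \<open>A cochain with coboundary \<open>c\<close> is lifted to A by \<open>push_j_ex\<close>,
  and j_* commutes with d.\<close>

lemma push_j_coboundaries:
  assumes "c \<in> coboundaries G r A''"
  obtains b where "b \<in> coboundaries G r A" and "push G r j b = c"
proof (cases r)
  case 0
  then show thesis
    using assms that[of "\<one>\<^bsub>cochain_group G 0 A\<^esub>"] by (simp add: coboundaries_def)
next
  case (Suc m)
  then obtain h where h: "h \<in> cochains G m A''" "c = coboundary G m A'' h"
    using assms by (auto simp: coboundaries_def)
  obtain e where "e \<in> cochains G m A" "push G m j e = h" by (rule push_j_ex[OF h(1)])
  with h Suc show thesis
    using that[of "coboundary G m A e"] A.coboundary_in_coboundaries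
    by (simp add: push_j_coboundary)
qed

text \<open>The factors are bracketed so that additivity and two uses of
  \<open>coh_class_eqI\<close> strip off first \<open>c\<close> and then the part from A'.\<close>

lemma lifts_differ:
  assumes f: "f \<in> lifts G r A A'' j \<alpha>" and f': "f' \<in> lifts G r A A'' j \<alpha>"
  obtains c u where "c \<in> coboundaries G r A" and "u \<in> cochains G r A'"
    and "f' = c \<otimes>\<^bsub>cochain_group G r A\<^esub> (push G r i u \<otimes>\<^bsub>cochain_group G r A\<^esub> f)"
proof -
  have cl: "f \<in> cochains G r A" "f' \<in> cochains G r A"
    and eq: "coh_class G r A'' (push G r j f') = coh_class G r A'' (push G r j f)"
    using f f' by (simp_all add: lifts_def)
  obtain c'' where c'': "c'' \<in> coboundaries G r A''"
    and pf': "push G r j f' = c'' \<otimes>\<^bsub>cochain_group G r A''\<^esub> push G r j f"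
    using A''.coh_class_eqE[OF push_j_closed[OF cl(2)] eq] .
  obtain c where c: "c \<in> coboundaries G r A" and pc: "push G r j c = c''"
    by (rule push_j_coboundaries[OF c''])
  have ccl: "c \<in> cochains G r A"
    using c subgroup.mem_carrier[OF A.coboundaries_subgroup] by simp
  let ?K = "cochain_group G r A"
  \<comment> \<open>Dividing \<open>f'\<close> by \<open>f\<close> and by the lifted coboundary
    leaves a cochain killed by j_* and therefore coming from A'.\<close>
  let ?e = "inv\<^bsub>?K\<^esub> c \<otimes>\<^bsub>?K\<^esub> (f' \<otimes>\<^bsub>?K\<^esub> inv\<^bsub>?K\<^esub> f)"
  have e: "?e \<in> cochains G r A" using cl ccl by simp
  have "push G r j ?e = \<one>\<^bsub>cochain_group G r A''\<^esub>"
    using cl ccl by (simp add: pf' pc A''.K.m_assoc push_j_closed flip: pc)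
  then obtain u where u: "u \<in> cochains G r A'" "push G r i u = ?e"
    using push_i_ex[OF e] by blast
  have "f' = c \<otimes>\<^bsub>?K\<^esub> (?e \<otimes>\<^bsub>?K\<^esub> f)"
    using cl ccl by (simp add: A.K.m_assoc) (simp flip: A.K.m_assoc)
  then show thesis using that c u by metis
qed

lemma lifts_cocycle_lift: "f \<in> lifts G r A A'' j \<alpha> \<Longrightarrow> cocycle_lift r f"
  by (simp add: lifts_def cocycle_lift_def)

lemma lifts_nonempty:
  assumes "\<alpha> \<in> carrier (cohomology G r A'')"
  shows "lifts G r A A'' j \<alpha> \<noteq> {}"
proof -
  obtain z where z: "z \<in> cocycles G r A''" "\<alpha> = coh_class G r A'' z"
    using assms by (auto simp: A''.carrier_cohomology)
  then obtain f where "f \<in> cochains G r A" "push G r j f = z"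
    using push_j_ex A''.cocycles_iff by metis
  with z have "f \<in> lifts G r A A'' j \<alpha>" by (simp add: lifts_def)
  then show ?thesis by blast
qed

lemma coboundary_lift_in_kernel:
  assumes "cocycle_lift r f"
  shows "coboundary G r A f \<in> Coset.kernel (cochain_group G (r + 1) A) (cochain_group G (r + 1) A'')
      (push G (r + 1) j)"
  using push_j_coboundary_lift[OF assms] A.coboundary_closed[OF cocycle_lift_cochains[OF assms]]
  by (simp add: Coset.kernel_def)

lemma ex1_coboundary_lift:
  assumes "cocycle_lift r f"
  shows "\<exists>!u. u \<in> cochains G (r + 1) A' \<and> push G (r + 1) i u = coboundary G r A f"
proof (rule ex1I[of _ "dlift r f"])
  fix u assume "u \<in> cochains G (r + 1) A' \<and> push G (r + 1) i u = coboundary G r A f"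
  then show "u = dlift r f" using dlift_unique[of u r f] by simp
qed (simp add: dlift[OF assms])

end


section \<open>The augmented cup product\<close>

locale tate =
  fixes G :: "'g top_group" and P :: "('g, 'a1, 'a, 'a2, 'b1, 'b, 'b2, 'c) tate_data"
  assumes tate: "tate_product G P"
begin

sublocale SA: short_exact_modules G "tA' P" "tA P" "tA'' P" "tiA P" "tjA P"
  using tate by unfold_locales (simp add: tate_product_def)

sublocale SB: short_exact_modules G "tB' P" "tB P" "tB'' P" "tiB P" "tjB P"
  using tate by unfold_locales (simp add: tate_product_def)

sublocale C: discrete_module G "tC P"
  using tate by (simp add: tate_product_def)

sublocale M1: module_pairing G "tA' P" "tB P" "tC P" "tpair1 P"
  using tate by unfold_locales (simp add: tate_product_def)

sublocale M2: module_pairing G "tA P" "tB' P" "tC P" "tpair2 P"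
  using tate by unfold_locales (simp add: tate_product_def)

abbreviation K :: "nat \<Rightarrow> ((nat \<Rightarrow> 'g) \<Rightarrow> 'c) monoid" where
  "K n \<equiv> cochain_group G n (tC P)"

abbreviation cup1 where "cup1 m n u g \<equiv> cup G m n (tB P) (tpair1 P) u g"

abbreviation cup2 where "cup2 m n f v \<equiv> cup G m n (tB' P) (tpair2 P) f v"

text \<open>Equivariance of \<open>tiB P\<close> moves the action inside B', where the two pairings
  agree.\<close>

lemma cup_compat:
  assumes u: "u \<in> cochains G m (tA' P)" and v: "v \<in> cochains G n (tB' P)"
  shows "cup1 m n u (push G n (tiB P) v) = cup2 m n (push G m (tiA P) u) v"
proof -
  have compat: "tpair1 P a (tiB P b) = tpair2 P (tiA P a) b"
    if "a \<in> carrier (tA' P)" "b \<in> carrier (tB' P)" for a b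
    using tate that by (simp add: tate_product_def)
  have "tpair1 P (u (restrict x {1..m}))
        (tuple_prod G m x \<odot>\<^bsub>tB P\<^esub> push G n (tiB P) v (shift m n x))
      = tpair2 P (push G m (tiA P) u (restrict x {1..m}))
        (tuple_prod G m x \<odot>\<^bsub>tB' P\<^esub> v (shift m n x))" if x: "x \<in> tuples G (m + n)" for x
  proof -
    have t: "tuple_prod G m x \<in> carrier G" by (rule SA.A'.tuple_prod_closed[OF x]) simp
    have y: "restrict x {1..m} \<in> tuples G m" by (rule SA.A'.restrict_in_tuples[OF x]) simp
    have z: "shift m n x \<in> tuples G n" by (rule SA.A'.shift_in_tuples[OF x]) simp
    have "tuple_prod G m x \<odot>\<^bsub>tB P\<^esub> tiB P (v (shift m n x))
        = tiB P (tuple_prod G m x \<odot>\<^bsub>tB' P\<^esub> v (shift m n x))"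
      using SB.i_equivariant t SA.A'.cochains_value[OF v z] by (simp add: equivariant_def)
    then show ?thesis
      using t y z SA.A'.cochains_value[OF u y] SA.A'.cochains_value[OF v z]
      by (simp add: SA.A'.push_apply compat SB.A'.act_closed del: One_nat_def)
  qed
  then show ?thesis unfolding cup_def by (auto intro!: restrict_ext simp del: One_nat_def)
qed

text \<open>The degree is a separate variable so that \<open>Suc r + s\<close> and
  \<open>r + Suc s\<close> can both be presented as \<open>Suc (r + s)\<close>.\<close>

lemma cup1_closed:
  assumes "u \<in> cochains G m (tA' P)" and "g \<in> cochains G n (tB P)" and "N = m + n"
  shows "cup1 m n u g \<in> cochains G N (tC P)"
  using M1.cup_closed assms by blast

lemma cup2_closed:
  assumes "f \<in> cochains G m (tA P)" and "v \<in> cochains G n (tB' P)" and "N = m + n"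
  shows "cup2 m n f v \<in> cochains G N (tC P)"
  using M2.cup_closed assms by blast

lemma cup1_one_left:
  assumes "g \<in> cochains G n (tB P)" and "N = m + n"
  shows "cup1 m n \<one>\<^bsub>cochain_group G m (tA' P)\<^esub> g = \<one>\<^bsub>K N\<^esub>"
  using hom_one[OF M1.cup_hom_left[OF assms(1)]] assms(2)
  by (simp add: SA.A'.K.is_group C.K.is_group)

lemma cup2_one_right:
  assumes "f \<in> cochains G m (tA P)" and "N = m + n"
  shows "cup2 m n f \<one>\<^bsub>cochain_group G n (tB' P)\<^esub> = \<one>\<^bsub>K N\<^esub>"
  using hom_one[OF M2.cup_hom_right[OF assms(1)]] assms(2)
  by (simp add: SB.A'.K.is_group C.K.is_group)

lemma cup_d_left_eq: "cup_d_left G P r s f g = cup1 (Suc r) s (SA.dlift r f) g"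
  by (simp add: cup_d_left_def SA.dlift_def)

lemma cup_d_right_eq: "cup_d_right G P r s f g = cup2 r (Suc s) f (SB.dlift s g)"
  by (simp add: cup_d_right_def SB.dlift_def)

abbreviation signed :: "nat \<Rightarrow> nat \<Rightarrow> ((nat \<Rightarrow> 'g) \<Rightarrow> 'c) \<Rightarrow> (nat \<Rightarrow> 'g) \<Rightarrow> 'c" where
  "signed N r w \<equiv> w [^]\<^bsub>K N\<^esub> ((-1) ^ r :: int)"

lemma signed_signed: "w \<in> cochains G N (tC P) \<Longrightarrow> signed N r (signed N r w) = w"
  by (simp add: C.K.int_pow_pow flip: power_add)

context
  fixes r s :: nat
begin

abbreviation N where "N \<equiv> Suc (r + s)"

context
  fixes f g
  assumes f: "SA.cocycle_lift r f" and g: "SB.cocycle_lift s g"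
begin

section \<open>The augmented cochain is a cocycle\<close>

lemma cup_d_left_closed: "cup1 (Suc r) s (SA.dlift r f) g \<in> cochains G N (tC P)"
  by (rule cup1_closed) (use SA.dlift[OF f] SB.cocycle_lift_cochains[OF g] in auto)

lemma cup_d_right_closed: "cup2 r (Suc s) f (SB.dlift s g) \<in> cochains G N (tC P)"
  by (rule cup2_closed) (use SB.dlift[OF g] SA.cocycle_lift_cochains[OF f] in auto)

lemma aug_cochain_eq:
  "aug_cochain G P r s f g =
    cup1 (Suc r) s (SA.dlift r f) g \<otimes>\<^bsub>K N\<^esub> signed N r (cup2 r (Suc s) f (SB.dlift s g))"
  unfolding aug_cochain_def cup_d_left_eq cup_d_right_eq SA.A'.cochain_group_simps
  by (auto intro!: restrict_ext simp: C.cochain_group_pow cup_d_right_closed)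

lemma aug_cochain_closed: "aug_cochain G P r s f g \<in> cochains G N (tC P)"
  by (simp add: aug_cochain_eq cup_d_left_closed cup_d_right_closed)

lemma coboundary_aug_cochain: "coboundary G N (tC P) (aug_cochain G P r s f g) = \<one>\<^bsub>K (Suc N)\<^esub>"
proof -
  note fc = SA.cocycle_lift_cochains[OF f] and gc = SB.cocycle_lift_cochains[OF g]
  let ?u = "SA.dlift r f" and ?v = "SB.dlift s g"
  let ?w = "cup2 (Suc r) (Suc s) (coboundary G r (tA P) f) ?v"
  have w: "?w \<in> cochains G (Suc N) (tC P)"
    by (rule cup2_closed) (use fc SA.A.coboundary_closed SB.dlift[OF g] in auto)
  have W: "cup1 (Suc r) (Suc s) ?u (coboundary G s (tB P) g) = ?w"
    using cup_compat[OF SA.dlift(1)[OF f] SB.dlift(1)[OF g]]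
    by (simp only: SA.dlift(2)[OF f] SB.dlift(2)[OF g])
  have "coboundary G N (tC P) (cup1 (Suc r) s ?u g) = signed (Suc N) (Suc r) ?w"
    using M1.coboundary_cup[OF SA.dlift(1)[OF f] gc] w
    by (simp add: W SA.coboundary_dlift[OF f] cup1_one_left[OF gc] del: power_Suc)
  moreover have "coboundary G N (tC P) (cup2 r (Suc s) f ?v) = ?w"
    using M2.coboundary_cup[OF fc SB.dlift(1)[OF g]] w
    by (simp add: SB.coboundary_dlift[OF g] cup2_one_right[OF fc])
  ultimately show ?thesis
    using w C.K.int_pow_sign_cancel[OF w, of r]
    by (simp add: aug_cochain_eq cup_d_left_closed cup_d_right_closed C.d.hom_int_pow C.K.m_comm
        del: power_Suc)
qed

lemma aug_cochain_cocycle: "aug_cochain G P r s f g \<in> cocycles G N (tC P)"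
  by (simp add: C.cocycles_iff aug_cochain_closed coboundary_aug_cochain)

end

section \<open>Additivity of the augmented cochain in each argument\<close>

lemma aug_cochain_mult_left:
  assumes f: "SA.cocycle_lift r f" and f': "SA.cocycle_lift r f'" and g: "SB.cocycle_lift s g"
  shows "aug_cochain G P r s (f \<otimes>\<^bsub>cochain_group G r (tA P)\<^esub> f') g
    = aug_cochain G P r s f g \<otimes>\<^bsub>K N\<^esub> aug_cochain G P r s f' g"
proof -
  have "cup1 (Suc r) s (SA.dlift r f \<otimes>\<^bsub>cochain_group G (Suc r) (tA' P)\<^esub> SA.dlift r f') g
      = cup1 (Suc r) s (SA.dlift r f) g \<otimes>\<^bsub>K N\<^esub> cup1 (Suc r) s (SA.dlift r f') g"
    using hom_mult[OF M1.cup_hom_left[OF SB.cocycle_lift_cochains[OF g], of "Suc r"]]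
      SA.dlift(1)[OF f] SA.dlift(1)[OF f'] by simp
  moreover have "cup2 r (Suc s) (f \<otimes>\<^bsub>cochain_group G r (tA P)\<^esub> f') (SB.dlift s g)
      = cup2 r (Suc s) f (SB.dlift s g) \<otimes>\<^bsub>K N\<^esub> cup2 r (Suc s) f' (SB.dlift s g)"
    using hom_mult[OF M2.cup_hom_left[OF SB.dlift(1)[OF g], of r]]
      SA.cocycle_lift_cochains[OF f] SA.cocycle_lift_cochains[OF f'] by simp
  ultimately show ?thesis
    using assms by (simp add: aug_cochain_eq SA.cocycle_lift_mult SA.dlift_mult C.K.int_pow_distrib
        cup_d_left_closed cup_d_right_closed C.K.m_ac)
qed

lemma aug_cochain_mult_right:
  assumes f: "SA.cocycle_lift r f" and g: "SB.cocycle_lift s g" and g': "SB.cocycle_lift s g'"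
  shows "aug_cochain G P r s f (g \<otimes>\<^bsub>cochain_group G s (tB P)\<^esub> g')
    = aug_cochain G P r s f g \<otimes>\<^bsub>K N\<^esub> aug_cochain G P r s f g'"
proof -
  have "cup1 (Suc r) s (SA.dlift r f) (g \<otimes>\<^bsub>cochain_group G s (tB P)\<^esub> g')
      = cup1 (Suc r) s (SA.dlift r f) g \<otimes>\<^bsub>K N\<^esub> cup1 (Suc r) s (SA.dlift r f) g'"
    using hom_mult[OF M1.cup_hom_right[OF SA.dlift(1)[OF f], of s]]
      SB.cocycle_lift_cochains[OF g] SB.cocycle_lift_cochains[OF g'] by simp
  moreover have "cup2 r (Suc s) f
        (SB.dlift s g \<otimes>\<^bsub>cochain_group G (Suc s) (tB' P)\<^esub> SB.dlift s g')
      = cup2 r (Suc s) f (SB.dlift s g) \<otimes>\<^bsub>K N\<^esub> cup2 r (Suc s) f (SB.dlift s g')"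
    using hom_mult[OF M2.cup_hom_right[OF SA.cocycle_lift_cochains[OF f], of "Suc s"]]
      SB.dlift(1)[OF g] SB.dlift(1)[OF g'] by simp
  ultimately show ?thesis
    using assms by (simp add: aug_cochain_eq SB.cocycle_lift_mult SB.dlift_mult C.K.int_pow_distrib
        cup_d_left_closed cup_d_right_closed C.K.m_ac)
qed

section \<open>Augmented cochains that are coboundaries\<close>

lemma signed_coboundary:
  assumes "w \<in> cochains G (r + s) (tC P)"
  shows "signed N k (coboundary G (r + s) (tC P) w) \<in> coboundaries G N (tC P)"
  using assms C.coboundary_in_coboundaries[of "w [^]\<^bsub>K (r + s)\<^esub> ((-1) ^ k :: int)" "r + s"]
  by (simp add: C.d.hom_int_pow)

text \<open>As \<open>dlift r c\<close> is the unit, only the term with v survives. Since d v = 0,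
  the Leibniz rule for h \<union> v has the single term d h \<union> v.\<close>

lemma aug_cochain_coboundary_left:
  assumes c: "c \<in> coboundaries G r (tA P)" and g: "SB.cocycle_lift s g"
  shows "aug_cochain G P r s c g \<in> coboundaries G N (tC P)"
proof -
  note cl = SA.cocycle_lift_coboundary[OF c]
  note vc = SB.dlift(1)[OF g]
  let ?v = "SB.dlift s g"
  have aug: "aug_cochain G P r s c g = signed N r (cup2 r (Suc s) c ?v)"
    using cup1_one_left[OF SB.cocycle_lift_cochains[OF g], of N "Suc r"] cup_d_right_closed[OF cl(1) g]
    by (simp add: aug_cochain_eq[OF cl(1) g] cl(2))
  show ?thesis
  proof (cases r)
    \<comment> \<open>Without an h of degree \<open>r - 1\<close>, the claim rests on
      \<open>c\<close> being the unit, which makes its cup product with v trivial.\<close>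
    case 0
    then have "c = \<one>\<^bsub>cochain_group G r (tA P)\<^esub>" using c by (simp add: coboundaries_def)
    then have "cup2 r (Suc s) c ?v = \<one>\<^bsub>K N\<^esub>"
      using hom_one[OF M2.cup_hom_left[OF vc, of r]] by (simp add: SA.A.K.is_group C.K.is_group)
    then show ?thesis
      using aug subgroup.one_closed[OF C.coboundaries_subgroup] by simp
  next
    case (Suc m)
    then obtain h where h: "h \<in> cochains G m (tA P)" "c = coboundary G m (tA P) h"
      using c by (auto simp: coboundaries_def)
    have w: "cup2 m (Suc s) h ?v \<in> cochains G (r + s) (tC P)"
      by (rule cup2_closed[OF h(1) vc]) (simp add: Suc)
    have "coboundary G (r + s) (tC P) (cup2 m (Suc s) h ?v) = cup2 r (Suc s) c ?v"
      using M2.coboundary_cup[OF h(1) vc] cup_d_right_closed[OF cl(1) g] Suc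
      by (simp add: SB.coboundary_dlift[OF g] cup2_one_right[OF h(1)] h(2))
    then show ?thesis using signed_coboundary[OF w, of r] aug by simp
  qed
qed

lemma aug_cochain_coboundary_right:
  assumes f: "SA.cocycle_lift r f" and c: "c \<in> coboundaries G s (tB P)"
  shows "aug_cochain G P r s f c \<in> coboundaries G N (tC P)"
proof -
  note cl = SB.cocycle_lift_coboundary[OF c]
  note uc = SA.dlift(1)[OF f]
  let ?u = "SA.dlift r f"
  have aug: "aug_cochain G P r s f c = cup1 (Suc r) s ?u c"
    using cup2_one_right[OF SA.cocycle_lift_cochains[OF f], of N "Suc s"] cup_d_left_closed[OF f cl(1)]
    by (simp add: aug_cochain_eq[OF f cl(1)] cl(2))
  show ?thesis
  proof (cases s)
    case 0
    then have "c = \<one>\<^bsub>cochain_group G s (tB P)\<^esub>" using c by (simp add: coboundaries_def)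
    then have "cup1 (Suc r) s ?u c = \<one>\<^bsub>K N\<^esub>"
      using hom_one[OF M1.cup_hom_right[OF uc, of s]] by (simp add: SB.A.K.is_group C.K.is_group)
    then show ?thesis
      using aug subgroup.one_closed[OF C.coboundaries_subgroup] by simp
  next
    case (Suc m)
    then obtain k where k: "k \<in> cochains G m (tB P)" "c = coboundary G m (tB P) k"
      using c by (auto simp: coboundaries_def)
    have w: "cup1 (Suc r) m ?u k \<in> cochains G (r + s) (tC P)"
      by (rule cup1_closed[OF uc k(1)]) (simp add: Suc)
    \<comment> \<open>Since d u = 0 and u has degree \<open>r + 1\<close>, the Leibniz rule leaves u
      \<union> d k with the sign (-1)^(r+1); \<open>signed_signed\<close> removes it below.\<close>
    have "coboundary G (r + s) (tC P) (cup1 (Suc r) m ?u k) = signed N (Suc r) (cup1 (Suc r) s ?u c)"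
      using M1.coboundary_cup[OF uc k(1)] cup_d_left_closed[OF f cl(1)] Suc
      by (simp add: SA.coboundary_dlift[OF f] cup1_one_left[OF k(1)] k(2) del: power_Suc)
    then show ?thesis
      using signed_coboundary[OF w, of "Suc r"] aug signed_signed[OF cup_d_left_closed[OF f cl(1)]]
      by (simp del: power_Suc)
  qed
qed

text \<open>Here \<open>dlift\<close> of the pushed cochain is d u, and \<open>cup_compat\<close>
  rewrites the second term as u \<union> d g, which gives exactly the Leibniz expansion of d(u
  \<union> g).\<close>

lemma aug_cochain_sub_left:
  assumes u: "u \<in> cochains G r (tA' P)" and g: "SB.cocycle_lift s g"
  shows "aug_cochain G P r s (push G r (tiA P) u) g \<in> coboundaries G N (tC P)"
proof -
  have gc: "g \<in> cochains G s (tB P)" by (rule SB.cocycle_lift_cochains[OF g])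
  have "aug_cochain G P r s (push G r (tiA P) u) g = coboundary G (r + s) (tC P) (cup1 r s u g)"
    using M1.coboundary_cup[OF u gc] SB.dlift[OF g] cup_compat[OF u SB.dlift(1)[OF g]]
    by (simp add: aug_cochain_eq SA.cocycle_lift_push[OF u] g)
  then show ?thesis
    using C.coboundary_in_coboundaries[OF cup1_closed[OF u gc refl]] by simp
qed

lemma aug_cochain_sub_right:
  assumes f: "SA.cocycle_lift r f" and b: "b \<in> cochains G s (tB' P)"
  shows "aug_cochain G P r s f (push G s (tiB P) b) \<in> coboundaries G N (tC P)"
proof -
  have fc: "f \<in> cochains G r (tA P)" by (rule SA.cocycle_lift_cochains[OF f])
  have "aug_cochain G P r s f (push G s (tiB P) b) = coboundary G (r + s) (tC P) (cup2 r s f b)"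
    using M2.coboundary_cup[OF fc b] SA.dlift[OF f] cup_compat[OF SA.dlift(1)[OF f] b]
    by (simp add: aug_cochain_eq SB.cocycle_lift_push[OF b] f)
  then show ?thesis
    using C.coboundary_in_coboundaries[OF cup2_closed[OF fc b refl]] by simp
qed

section \<open>Independence of the chosen lifts\<close>

lemma coh_class_aug_cochain_left:
  assumes f: "f \<in> lifts G r (tA P) (tA'' P) (tjA P) \<alpha>"
    and f': "f' \<in> lifts G r (tA P) (tA'' P) (tjA P) \<alpha>" and g: "SB.cocycle_lift s g"
  shows "coh_class G N (tC P) (aug_cochain G P r s f' g)
    = coh_class G N (tC P) (aug_cochain G P r s f g)"
proof -
  note fl = SA.lifts_cocycle_lift[OF f]
  obtain c u where c: "c \<in> coboundaries G r (tA P)" and u: "u \<in> cochains G r (tA' P)"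
    and eq: "f' = c \<otimes>\<^bsub>cochain_group G r (tA P)\<^esub>
      (push G r (tiA P) u \<otimes>\<^bsub>cochain_group G r (tA P)\<^esub> f)"
    using SA.lifts_differ[OF f f'] .
  note cl = SA.cocycle_lift_coboundary(1)[OF c] and ul = SA.cocycle_lift_push(1)[OF u]
  show ?thesis
    unfolding eq using fl g cl ul
    by (simp add: aug_cochain_mult_left SA.cocycle_lift_mult C.coh_class_eqI aug_cochain_closed
        aug_cochain_coboundary_left[OF c] aug_cochain_sub_left[OF u])
qed

lemma coh_class_aug_cochain_right:
  assumes g: "g \<in> lifts G s (tB P) (tB'' P) (tjB P) \<beta>"
    and g': "g' \<in> lifts G s (tB P) (tB'' P) (tjB P) \<beta>" and f: "SA.cocycle_lift r f"
  shows "coh_class G N (tC P) (aug_cochain G P r s f g')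
    = coh_class G N (tC P) (aug_cochain G P r s f g)"
proof -
  note gl = SB.lifts_cocycle_lift[OF g]
  obtain c u where c: "c \<in> coboundaries G s (tB P)" and u: "u \<in> cochains G s (tB' P)"
    and eq: "g' = c \<otimes>\<^bsub>cochain_group G s (tB P)\<^esub>
      (push G s (tiB P) u \<otimes>\<^bsub>cochain_group G s (tB P)\<^esub> g)"
    using SB.lifts_differ[OF g g'] .
  note cl = SB.cocycle_lift_coboundary(1)[OF c] and ul = SB.cocycle_lift_push(1)[OF u]
  show ?thesis
    unfolding eq using gl f cl ul
    by (simp add: aug_cochain_mult_right SB.cocycle_lift_mult C.coh_class_eqI aug_cochain_closed
        aug_cochain_coboundary_right[OF _ c] aug_cochain_sub_right[OF _ u])
qed

text \<open>The lifts are exchanged one at a time, \<open>f'\<close> for \<open>f\<close> beside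
  \<open>g'\<close> and then \<open>g'\<close> for \<open>g\<close> beside \<open>f\<close>.\<close>

lemma coh_class_aug_cochain:
  assumes f: "f \<in> lifts G r (tA P) (tA'' P) (tjA P) \<alpha>"
    and f': "f' \<in> lifts G r (tA P) (tA'' P) (tjA P) \<alpha>"
    and g: "g \<in> lifts G s (tB P) (tB'' P) (tjB P) \<beta>"
    and g': "g' \<in> lifts G s (tB P) (tB'' P) (tjB P) \<beta>"
  shows "coh_class G N (tC P) (aug_cochain G P r s f' g')
    = coh_class G N (tC P) (aug_cochain G P r s f g)"
  using coh_class_aug_cochain_left[OF f f' SB.lifts_cocycle_lift[OF g']]
    coh_class_aug_cochain_right[OF g g' SA.lifts_cocycle_lift[OF f]] by simp

end

end


theorem proposition3p5:
  fixes G :: "'g top_group"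
    and P :: "('g, 'a1, 'a, 'a2, 'b1, 'b, 'b2, 'c) tate_data"
    and r s :: nat
  assumes "profinite_group G"
    and "tate_product G P"
  shows
    "(\<forall>\<alpha> \<in> carrier (cohomology G r (tA'' P)). lifts G r (tA P) (tA'' P) (tjA P) \<alpha> \<noteq> {}) \<and>
     (\<forall>\<beta> \<in> carrier (cohomology G s (tB'' P)). lifts G s (tB P) (tB'' P) (tjB P) \<beta> \<noteq> {}) \<and>
     (\<forall>\<alpha> \<in> carrier (cohomology G r (tA'' P)). \<forall>\<beta> \<in> carrier (cohomology G s (tB'' P)).
      \<forall>f \<in> lifts G r (tA P) (tA'' P) (tjA P) \<alpha>. \<forall>g \<in> lifts G s (tB P) (tB'' P) (tjB P) \<beta>.
        coboundary G r (tA P) f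
          \<in> Coset.kernel (cochain_group G (r + 1) (tA P)) (cochain_group G (r + 1) (tA'' P))
              (push G (r + 1) (tjA P)) \<and>
        (\<exists>!u. u \<in> cochains G (r + 1) (tA' P) \<and> push G (r + 1) (tiA P) u = coboundary G r (tA P) f) \<and>
        coboundary G s (tB P) g
          \<in> Coset.kernel (cochain_group G (s + 1) (tB P)) (cochain_group G (s + 1) (tB'' P))
              (push G (s + 1) (tjB P)) \<and>
        (\<exists>!v. v \<in> cochains G (s + 1) (tB' P) \<and> push G (s + 1) (tiB P) v = coboundary G s (tB P) g) \<and>
        cup_d_left G P r s f g \<in> cochains G (r + s + 1) (tC P) \<and>
        cup_d_right G P r s f g \<in> cochains G (r + s + 1) (tC P) \<and>
        aug_cochain G P r s f g \<in> cocycles G (r + s + 1) (tC P) \<and>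
        (\<forall>f' \<in> lifts G r (tA P) (tA'' P) (tjA P) \<alpha>. \<forall>g' \<in> lifts G s (tB P) (tB'' P) (tjB P) \<beta>.
           coh_class G (r + s + 1) (tC P) (aug_cochain G P r s f' g')
             = coh_class G (r + s + 1) (tC P) (aug_cochain G P r s f g))) \<and>
     (\<exists>!aug. aug \<in> carrier (cohomology G r (tA'' P)) \<times> carrier (cohomology G s (tB'' P))
                     \<rightarrow>\<^sub>E carrier (cohomology G (r + s + 1) (tC P)) \<and>
       (\<forall>\<alpha> \<in> carrier (cohomology G r (tA'' P)). \<forall>\<beta> \<in> carrier (cohomology G s (tB'' P)).
        \<forall>f \<in> lifts G r (tA P) (tA'' P) (tjA P) \<alpha>. \<forall>g \<in> lifts G s (tB P) (tB'' P) (tjB P) \<beta>.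
          aug (\<alpha>, \<beta>) = coh_class G (r + s + 1) (tC P) (aug_cochain G P r s f g)))"
proof -
  interpret tate G P by unfold_locales (rule assms(2))
  let ?LA = "lifts G r (tA P) (tA'' P) (tjA P)" and ?LB = "lifts G s (tB P) (tB'' P) (tjB P)"
  let ?HA = "carrier (cohomology G r (tA'' P))" and ?HB = "carrier (cohomology G s (tB'' P))"
  let ?c = "\<lambda>f g. coh_class G (r + s + 1) (tC P) (aug_cochain G P r s f g)"
  have nA: "?LA \<alpha> \<noteq> {}" if "\<alpha> \<in> ?HA" for \<alpha>
    using SA.lifts_nonempty that .
  have nB: "?LB \<beta> \<noteq> {}" if "\<beta> \<in> ?HB" for \<beta>
    using SB.lifts_nonempty that .
  have indep: "?c f' g' = ?c f g"
    if "f \<in> ?LA \<alpha>" "g \<in> ?LB \<beta>" "f' \<in> ?LA \<alpha>" "g' \<in> ?LB \<beta>" for f g f' g' \<alpha> \<beta>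
    using coh_class_aug_cochain[OF that(1,3,2,4)] by simp
  have main: "coboundary G r (tA P) f
          \<in> Coset.kernel (cochain_group G (r + 1) (tA P)) (cochain_group G (r + 1) (tA'' P))
              (push G (r + 1) (tjA P)) \<and>
        (\<exists>!u. u \<in> cochains G (r + 1) (tA' P) \<and> push G (r + 1) (tiA P) u = coboundary G r (tA P) f) \<and>
        coboundary G s (tB P) g
          \<in> Coset.kernel (cochain_group G (s + 1) (tB P)) (cochain_group G (s + 1) (tB'' P))
              (push G (s + 1) (tjB P)) \<and>
        (\<exists>!v. v \<in> cochains G (s + 1) (tB' P) \<and> push G (s + 1) (tiB P) v = coboundary G s (tB P) g) \<and>
        cup_d_left G P r s f g \<in> cochains G (r + s + 1) (tC P) \<and>
        cup_d_right G P r s f g \<in> cochains G (r + s + 1) (tC P) \<and>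
        aug_cochain G P r s f g \<in> cocycles G (r + s + 1) (tC P) \<and>
        (\<forall>f' \<in> ?LA \<alpha>. \<forall>g' \<in> ?LB \<beta>. ?c f' g' = ?c f g)"
    if "f \<in> ?LA \<alpha>" "g \<in> ?LB \<beta>" for f g \<alpha> \<beta>
  proof -
    note fl = SA.lifts_cocycle_lift[OF that(1)] and gl = SB.lifts_cocycle_lift[OF that(2)]
    have N: "r + s + 1 = Suc (r + s)" by simp
    show ?thesis
      unfolding cup_d_left_eq cup_d_right_eq N
      by (intro conjI SA.coboundary_lift_in_kernel SB.coboundary_lift_in_kernel
          SA.ex1_coboundary_lift SB.ex1_coboundary_lift cup_d_left_closed cup_d_right_closed
          aug_cochain_cocycle fl gl ballI coh_class_aug_cochain[OF that(1) _ that(2)])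
  qed
  define fA where "fA \<alpha> = (SOME f. f \<in> ?LA \<alpha>)" for \<alpha>
  define gB where "gB \<beta> = (SOME g. g \<in> ?LB \<beta>)" for \<beta>
  have fA: "fA \<alpha> \<in> ?LA \<alpha>" if "\<alpha> \<in> ?HA" for \<alpha>
    unfolding fA_def using nA[OF that] by (simp add: some_in_eq)
  have gB: "gB \<beta> \<in> ?LB \<beta>" if "\<beta> \<in> ?HB" for \<beta>
    unfolding gB_def using nB[OF that] by (simp add: some_in_eq)
  have "\<exists>!aug. aug \<in> ?HA \<times> ?HB \<rightarrow>\<^sub>E carrier (cohomology G (r + s + 1) (tC P)) \<and>
       (\<forall>\<alpha> \<in> ?HA. \<forall>\<beta> \<in> ?HB. \<forall>f \<in> ?LA \<alpha>. \<forall>g \<in> ?LB \<beta>. aug (\<alpha>, \<beta>) = ?c f g)"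
  \<comment> \<open>The witness evaluates at chosen lifts; \<open>indep\<close> makes the choice
    immaterial. Restricting it to pairs of classes makes it extensional, so that uniqueness is
    equality of functions.\<close>
  proof (rule ex1I[of _ "\<lambda>(\<alpha>, \<beta>)\<in>?HA \<times> ?HB. ?c (fA \<alpha>) (gB \<beta>)"], intro conjI ballI)
    have "?c (fA \<alpha>) (gB \<beta>) \<in> carrier (cohomology G (r + s + 1) (tC P))"
      if "\<alpha> \<in> ?HA" "\<beta> \<in> ?HB" for \<alpha> \<beta>
      using main[OF fA[OF that(1)] gB[OF that(2)]] by (simp add: C.carrier_cohomology)
    then show "(\<lambda>(\<alpha>, \<beta>)\<in>?HA \<times> ?HB. ?c (fA \<alpha>) (gB \<beta>))
        \<in> ?HA \<times> ?HB \<rightarrow>\<^sub>E carrier (cohomology G (r + s + 1) (tC P))"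
      by (intro restrict_PiE_iff[THEN iffD2] ballI) (clarsimp simp del: One_nat_def add_Suc_right)
  next
    fix \<alpha> \<beta> f g
    assume "\<alpha> \<in> ?HA" "\<beta> \<in> ?HB" "f \<in> ?LA \<alpha>" "g \<in> ?LB \<beta>"
    then show "(\<lambda>(\<alpha>, \<beta>)\<in>?HA \<times> ?HB. ?c (fA \<alpha>) (gB \<beta>)) (\<alpha>, \<beta>) = ?c f g"
      using indep[OF _ _ fA gB] by simp
  next
    fix aug
    assume aug: "aug \<in> ?HA \<times> ?HB \<rightarrow>\<^sub>E carrier (cohomology G (r + s + 1) (tC P)) \<and>
       (\<forall>\<alpha> \<in> ?HA. \<forall>\<beta> \<in> ?HB. \<forall>f \<in> ?LA \<alpha>. \<forall>g \<in> ?LB \<beta>. aug (\<alpha>, \<beta>) = ?c f g)"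
    show "aug = (\<lambda>(\<alpha>, \<beta>)\<in>?HA \<times> ?HB. ?c (fA \<alpha>) (gB \<beta>))"
    proof (rule extensionalityI[of _ "?HA \<times> ?HB"])
      show "aug \<in> extensional (?HA \<times> ?HB)" using aug by (simp add: PiE_iff)
      fix z assume "z \<in> ?HA \<times> ?HB"
      then obtain \<alpha> \<beta> where "z = (\<alpha>, \<beta>)" "\<alpha> \<in> ?HA" "\<beta> \<in> ?HB" by blast
      \<comment> \<open>Every class has a lift, so the value of \<open>aug\<close> is forced by its
        equation at \<open>fA\<close> and \<open>gB\<close>.\<close>
      then show "aug z = (\<lambda>(\<alpha>, \<beta>)\<in>?HA \<times> ?HB. ?c (fA \<alpha>) (gB \<beta>)) z"
        using conjunct2[OF aug] fA gB by simp
    qed auto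
  qed
  with nA nB main show ?thesis
    by (intro conjI[OF ballI conjI[OF ballI conjI]] ballI)
qed

end
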